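(* For multipointed $d$-spaces there are the implications q-cofibrant $\Rightarrow$ m-cofibrant $\Rightarrow$ h-cofibrant; that is, every object of $\mathcal{G}\mathbf{dTop}$ that is cofibrant in the q-model structure is cofibrant in the m-model structure, and every object that is cofibrant in the m-model structure is cofibrant in the h-model structure. Moreover, the identity functor yields a Quillen equivalence $\mathrm{Id}:(\mathcal{G}\mathbf{dTop})_q\dashv(\mathcal{G}\mathbf{dTop})_m:\mathrm{Id}$ (with left adjoint going from the q-model structure to the m-model structure).
   Context: $\mathbf{Top}$ is the category of $\Delta$-generated spaces, i.e. topological spaces that are colimits of standard topological simplices; it is cartesian closed with internal hom $\mathbf{TOP}(-,-)$. The kelleyfication is the right adjoint of the inclusion of $\mathbf{Top}$ into all topological spaces (it does not change underlying sets). A q-fibration of $\mathbf{Top}$ is a map with the right lifting property with respect to the inclusions $\mathbf{D}^n\times\{0\}\subset \mathbf{D}^n\times[0,1]$, $n\ge 0$. An h-fibration is a map with the right lifting property with respect to $Z\times\{0\}\subset Z\times[0,1]$ for all spaces $Z$ of $\mathbf{Top}$. $\mathcal{G}$ is the topological group of nondecreasing homeomorphisms $[0,1]\to[0,1]$. For continuous $\gamma_1,\gamma_2:[0,1]\to U$ with $\gamma_1(1)=\gamma_2(0)$, the normalized composition $\gamma_1 *_N\gamma_2:[0,1]\to U$ is $\gamma_1(2t)$ for $t\le 1/2$ and $\gamma_2(2t-1)$ for $t\geq 1/2$. A multipointed $d$-space $X$ is a triple $(|X|,X^0,\mathbb{P}^{\mathcal{G}}X)$ where $|X|$ is a space of $\mathbf{Top}$,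 $X^0\subset |X|$ is a subset (the states), and $\mathbb{P}^{\mathcal{G}}X$ is a set of continuous maps $[0,1]\to|X|$ (the execution paths) such that: $\gamma(0),\gamma(1)\in X^0$ for every execution path $\gamma$; $\gamma.\phi$ is an execution path for every execution path $\gamma$ and every $\phi\in\mathcal{G}$; $\gamma_1*_N\gamma_2$ is an execution path for all composable execution paths $\gamma_1,\gamma_2$. A map $f:X\to Y$ is a continuous map $|X|\to|Y|$ taking $X^0$ to $Y^0$ (inducing $f^0:X^0\to Y^0$) such that $f.\gamma\in\mathbb{P}^{\mathcal{G}}Y$ for all $\gamma\in\mathbb{P}^{\mathcal{G}}X$. The category is $\mathcal{G}\mathbf{dTop}$. $\mathbb{P}^{\mathcal{G}}_{\alpha,\beta}X$ is the set of execution paths from $\alpha$ to $\beta$, equipped with the kelleyfication of the relative topology from $\mathbf{TOP}([0,1],|X|)$. The q-, h- and m-model structures $(\mathcal{G}\mathbf{dTop})_q$, $(\mathcal{G}\mathbf{dTop})_h$, $(\mathcal{G}\mathbf{dTop})_m$ are the unique model structures such that $f:X\to Y$ is a weak equivalence iff $f^0$ is a bijection and each $\mathbb{P}^{\mathcal{G}}_{\alpha,\beta}X\to \mathbb{P}^{\mathcal{G}}_{f(\alpha),f(\beta)}Y$ belongs to $\mathcal{W}$, and a fibration iff each such map belongs to $\mathcal{F}$, where: for q, $\mathcal{W}$ = weak homotopy equivalences and $\mathcal{F}$ = q-fibrations; for h, $\mathcal{W}$ = homotopy equivalences and $\mathcal{F}$ = h-fibrations; for m, $\mathcal{W}$ =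 weak homotopy equivalences and $\mathcal{F}$ = h-fibrations. These model structures exist. *)

theory Defs
  imports "HOL-Homology.Simplices" "HOL-Analysis.Sum_Topology" "HOL-Library.Equipollence"
begin

section \<open>Categories, adjunctions and model structures\<close>

record ('o, 'a) cat =
  Obj :: "'o set"
  Arr :: "'a set"
  Dom :: "'a \<Rightarrow> 'o"
  Cod :: "'a \<Rightarrow> 'o"
  Cmp :: "'a \<Rightarrow> 'a \<Rightarrow> 'a"
  Idt :: "'o \<Rightarrow> 'a"

text \<open>\<open>Cmp C g f\<close> is the composite \<open>g\<close> after \<open>f\<close>; it is only meaningful when
  \<open>Cod C f = Dom C g\<close>.\<close>

definition Hom :: "('o, 'a) cat \<Rightarrow> 'o \<Rightarrow> 'o \<Rightarrow> 'a set" where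
  "Hom C X Y = {f \<in> Arr C. Dom C f = X \<and> Cod C f = Y}"

definition is_category :: "('o, 'a) cat \<Rightarrow> bool" where
  "is_category C \<longleftrightarrow>
     (\<forall>f\<in>Arr C. Dom C f \<in> Obj C \<and> Cod C f \<in> Obj C) \<and>
     (\<forall>X\<in>Obj C. Idt C X \<in> Hom C X X) \<and>
     (\<forall>f\<in>Arr C. \<forall>g\<in>Arr C. Cod C f = Dom C g \<longrightarrow> Cmp C g f \<in> Hom C (Dom C f) (Cod C g)) \<and>
     (\<forall>f\<in>Arr C. Cmp C f (Idt C (Dom C f)) = f \<and> Cmp C (Idt C (Cod C f)) f = f) \<and>
     (\<forall>f\<in>Arr C. \<forall>g\<in>Arr C. \<forall>h\<in>Arr C. Cod C f = Dom C g \<longrightarrow> Cod C g = Dom C h \<longrightarrow>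
        Cmp C h (Cmp C g f) = Cmp C (Cmp C h g) f)"

definition initial_object :: "('o, 'a) cat \<Rightarrow> 'o \<Rightarrow> bool" where
  "initial_object C A \<longleftrightarrow> A \<in> Obj C \<and> (\<forall>X\<in>Obj C. \<exists>!f. f \<in> Hom C A X)"

definition terminal_object :: "('o, 'a) cat \<Rightarrow> 'o \<Rightarrow> bool" where
  "terminal_object C A \<longleftrightarrow> A \<in> Obj C \<and> (\<forall>X\<in>Obj C. \<exists>!f. f \<in> Hom C X A)"

definition has_lifting :: "('o, 'a) cat \<Rightarrow> 'a \<Rightarrow> 'a \<Rightarrow> bool" where
  "has_lifting C i p \<longleftrightarrow>
     (\<forall>u\<in>Hom C (Dom C i) (Dom C p). \<forall>v\<in>Hom C (Cod C i) (Cod C p).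
        Cmp C p u = Cmp C v i \<longrightarrow>
        (\<exists>l\<in>Hom C (Cod C i) (Dom C p). Cmp C l i = u \<and> Cmp C p l = v))"

definition retract_of_arrow :: "('o, 'a) cat \<Rightarrow> 'a \<Rightarrow> 'a \<Rightarrow> bool" where
  "retract_of_arrow C f g \<longleftrightarrow>
     (\<exists>i\<in>Hom C (Dom C f) (Dom C g). \<exists>r\<in>Hom C (Dom C g) (Dom C f).
      \<exists>j\<in>Hom C (Cod C f) (Cod C g). \<exists>s\<in>Hom C (Cod C g) (Cod C f).
        Cmp C r i = Idt C (Dom C f) \<and> Cmp C s j = Idt C (Cod C f) \<and>
        Cmp C g i = Cmp C j f \<and> Cmp C f r = Cmp C s g)"

record 'a arrow_classes =
  Weq :: "'a set"
  Cof :: "'a set"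
  Fib :: "'a set"

definition closed_under_retracts :: "('o, 'a) cat \<Rightarrow> 'a set \<Rightarrow> bool" where
  "closed_under_retracts C S \<longleftrightarrow>
     (\<forall>f\<in>Arr C. \<forall>g\<in>S. retract_of_arrow C f g \<longrightarrow> f \<in> S)"

definition two_out_of_three :: "('o, 'a) cat \<Rightarrow> 'a set \<Rightarrow> bool" where
  "two_out_of_three C S \<longleftrightarrow>
     (\<forall>f\<in>Arr C. \<forall>g\<in>Arr C. Cod C f = Dom C g \<longrightarrow>
        (f \<in> S \<and> g \<in> S \<longrightarrow> Cmp C g f \<in> S) \<and>
        (f \<in> S \<and> Cmp C g f \<in> S \<longrightarrow> g \<in> S) \<and>
        (g \<in> S \<and> Cmp C g f \<in> S \<longrightarrow> f \<in> S))"

definition model_structure :: "('o, 'a) cat \<Rightarrow> 'a arrow_classes \<Rightarrow> bool" where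
  "model_structure C M \<longleftrightarrow>
     is_category C \<and>
     Weq M \<subseteq> Arr C \<and> Cof M \<subseteq> Arr C \<and> Fib M \<subseteq> Arr C \<and>
     two_out_of_three C (Weq M) \<and>
     closed_under_retracts C (Weq M) \<and>
     closed_under_retracts C (Cof M) \<and>
     closed_under_retracts C (Fib M) \<and>
     (\<forall>i\<in>Cof M. \<forall>p\<in>Fib M \<inter> Weq M. has_lifting C i p) \<and>
     (\<forall>i\<in>Cof M \<inter> Weq M. \<forall>p\<in>Fib M. has_lifting C i p) \<and>
     (\<forall>f\<in>Arr C. \<exists>i\<in>Cof M. \<exists>p\<in>Fib M \<inter> Weq M. Cod C i = Dom C p \<and> f = Cmp C p i) \<and>
     (\<forall>f\<in>Arr C. \<exists>i\<in>Cof M \<inter> Weq M. \<exists>p\<in>Fib M. Cod C i = Dom C p \<and> f = Cmp C p i)"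

definition cofibrant :: "('o, 'a) cat \<Rightarrow> 'a arrow_classes \<Rightarrow> 'o \<Rightarrow> bool" where
  "cofibrant C M X \<longleftrightarrow>
     X \<in> Obj C \<and> (\<exists>A. initial_object C A \<and> (\<exists>i\<in>Hom C A X. i \<in> Cof M))"

definition fibrant :: "('o, 'a) cat \<Rightarrow> 'a arrow_classes \<Rightarrow> 'o \<Rightarrow> bool" where
  "fibrant C M X \<longleftrightarrow>
     X \<in> Obj C \<and> (\<exists>A. terminal_object C A \<and> (\<exists>p\<in>Hom C X A. p \<in> Fib M))"

record ('o, 'a, 'p, 'b) functr =
  OnObj :: "'o \<Rightarrow> 'p"
  OnArr :: "'a \<Rightarrow> 'b"

definition is_functor ::
  "('o, 'a) cat \<Rightarrow> ('p, 'b) cat \<Rightarrow> ('o, 'a, 'p, 'b) functr \<Rightarrow> bool" where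
  "is_functor C D F \<longleftrightarrow>
     is_category C \<and> is_category D \<and>
     (\<forall>X\<in>Obj C. OnObj F X \<in> Obj D) \<and>
     (\<forall>f\<in>Arr C. OnArr F f \<in> Hom D (OnObj F (Dom C f)) (OnObj F (Cod C f))) \<and>
     (\<forall>X\<in>Obj C. OnArr F (Idt C X) = Idt D (OnObj F X)) \<and>
     (\<forall>f\<in>Arr C. \<forall>g\<in>Arr C. Cod C f = Dom C g \<longrightarrow>
        OnArr F (Cmp C g f) = Cmp D (OnArr F g) (OnArr F f))"

definition identity_functor :: "('o, 'a, 'o, 'a) functr" where
  "identity_functor = \<lparr>OnObj = (\<lambda>X. X), OnArr = (\<lambda>f. f)\<rparr>"

text \<open>\<open>F\<close> is left adjoint to \<open>G\<close>, with hom-set bijections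
  \<open>\<Phi> X Y : Hom(F X, Y) \<rightarrow> Hom(X, G Y)\<close> natural in both variables.\<close>

definition adjunction ::
  "('o, 'a) cat \<Rightarrow> ('p, 'b) cat \<Rightarrow> ('o, 'a, 'p, 'b) functr \<Rightarrow> ('p, 'b, 'o, 'a) functr \<Rightarrow>
   ('o \<Rightarrow> 'p \<Rightarrow> 'b \<Rightarrow> 'a) \<Rightarrow> bool" where
  "adjunction C D F G \<Phi> \<longleftrightarrow>
     is_functor C D F \<and> is_functor D C G \<and>
     (\<forall>X\<in>Obj C. \<forall>Y\<in>Obj D.
        bij_betw (\<Phi> X Y) (Hom D (OnObj F X) Y) (Hom C X (OnObj G Y))) \<and>
     (\<forall>u\<in>Arr C. \<forall>v\<in>Arr D. \<forall>f\<in>Hom D (OnObj F (Cod C u)) (Dom D v).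
        \<Phi> (Dom C u) (Cod D v) (Cmp D v (Cmp D f (OnArr F u))) =
        Cmp C (OnArr G v) (Cmp C (\<Phi> (Cod C u) (Dom D v) f) u))"

definition quillen_adjunction ::
  "('o, 'a) cat \<Rightarrow> 'a arrow_classes \<Rightarrow> ('p, 'b) cat \<Rightarrow> 'b arrow_classes \<Rightarrow>
   ('o, 'a, 'p, 'b) functr \<Rightarrow> ('p, 'b, 'o, 'a) functr \<Rightarrow> ('o \<Rightarrow> 'p \<Rightarrow> 'b \<Rightarrow> 'a) \<Rightarrow> bool" where
  "quillen_adjunction C M D N F G \<Phi> \<longleftrightarrow>
     model_structure C M \<and> model_structure D N \<and> adjunction C D F G \<Phi> \<and>
     (\<forall>f\<in>Cof M. OnArr F f \<in> Cof N) \<and>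
     (\<forall>f\<in>Cof M \<inter> Weq M. OnArr F f \<in> Cof N \<inter> Weq N)"

definition quillen_equivalence ::
  "('o, 'a) cat \<Rightarrow> 'a arrow_classes \<Rightarrow> ('p, 'b) cat \<Rightarrow> 'b arrow_classes \<Rightarrow>
   ('o, 'a, 'p, 'b) functr \<Rightarrow> ('p, 'b, 'o, 'a) functr \<Rightarrow> ('o \<Rightarrow> 'p \<Rightarrow> 'b \<Rightarrow> 'a) \<Rightarrow> bool" where
  "quillen_equivalence C M D N F G \<Phi> \<longleftrightarrow>
     quillen_adjunction C M D N F G \<Phi> \<and>
     (\<forall>X Y. cofibrant C M X \<longrightarrow> fibrant D N Y \<longrightarrow>
        (\<forall>f\<in>Hom D (OnObj F X) Y. f \<in> Weq N \<longleftrightarrow> \<Phi> X Y f \<in> Weq M))"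


section \<open>Delta-generated spaces\<close>

abbreviation simplex :: "nat \<Rightarrow> (nat \<Rightarrow> real) topology" where
  "simplex p \<equiv> subtopology (powertop_real UNIV) (standard_simplex p)"

text \<open>A space is Delta-generated if it carries the final topology for its singular simplices.
  Lemma \<open>delta_generated_iff_quotient\<close> shows that these are exactly the quotients of disjoint
  sums of standard simplices. Those are exactly the colimits of simplices: a colimit is a quotient
  of the coproduct, and a quotient is the colimit of the summands together with one point
  (a simplex of dimension 0) for each pair of identified points.\<close>

definition delta_generated :: "'a topology \<Rightarrow> bool" where
  "delta_generated X \<longleftrightarrow>
     (\<forall>U. U \<subseteq> topspace X \<longrightarrow>
        (\<forall>p f. continuous_map (simplex p) X f \<longrightarrow>
           openin (simplex p) {x \<in> topspace (simplex p). f x \<in> U}) \<longrightarrow>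
        openin X U)"

text \<open>Right adjoint of the inclusion of Delta-generated spaces into all spaces; see
  \<open>continuous_map_into_kelleyfication\<close>.\<close>

definition kelleyfication :: "'a topology \<Rightarrow> 'a topology" where
  "kelleyfication X = topology (\<lambda>U. U \<subseteq> topspace X \<and>
     (\<forall>p f. continuous_map (simplex p) X f \<longrightarrow>
        openin (simplex p) {x \<in> topspace (simplex p). f x \<in> U}))"

lemma openin_kelleyfication:
  "openin (kelleyfication X) U \<longleftrightarrow> U \<subseteq> topspace X \<and>
     (\<forall>p f. continuous_map (simplex p) X f \<longrightarrow>
        openin (simplex p) {x \<in> topspace (simplex p). f x \<in> U})"
proof -
  let ?L = "\<lambda>U. U \<subseteq> topspace X \<and>
     (\<forall>p f. continuous_map (simplex p) X f \<longrightarrow>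
        openin (simplex p) {x \<in> topspace (simplex p). f x \<in> U})"
  have "istopology ?L"
    unfolding istopology_def
  proof (intro conjI allI impI)
    fix S T p f
    assume S: "?L S" and T: "?L T"
    then show "S \<inter> T \<subseteq> topspace X" by blast
    assume f: "continuous_map (simplex p) X f"
    have "{x \<in> topspace (simplex p). f x \<in> S \<inter> T} =
          {x \<in> topspace (simplex p). f x \<in> S} \<inter> {x \<in> topspace (simplex p). f x \<in> T}"
      by blast
    moreover have "openin (simplex p) {x \<in> topspace (simplex p). f x \<in> S}"
      and "openin (simplex p) {x \<in> topspace (simplex p). f x \<in> T}"
      using S T f by blast+
    ultimately show "openin (simplex p) {x \<in> topspace (simplex p). f x \<in> S \<inter> T}"
      by (simp only: openin_Int)
  next
    fix K p f
    assume K: "\<forall>U\<in>K. ?L U"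
    then show "\<Union>K \<subseteq> topspace X" by blast
    assume f: "continuous_map (simplex p) X f"
    have "{x \<in> topspace (simplex p). f x \<in> \<Union>K} =
          (\<Union>U\<in>K. {x \<in> topspace (simplex p). f x \<in> U})"
      by blast
    moreover have "openin (simplex p) (\<Union>U\<in>K. {x \<in> topspace (simplex p). f x \<in> U})"
    proof (rule openin_Union)
      fix V
      assume "V \<in> (\<lambda>U. {x \<in> topspace (simplex p). f x \<in> U}) ` K"
      then obtain U where "U \<in> K" and V: "V = {x \<in> topspace (simplex p). f x \<in> U}"
        by blast
      then have "?L U"
        using K by blast
      then show "openin (simplex p) V"
        unfolding V using f by blast
    qed
    ultimately show "openin (simplex p) {x \<in> topspace (simplex p). f x \<in> \<Union>K}"
      by (simp only:)
  qed
  then show ?thesis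
    by (simp add: kelleyfication_def)
qed

lemma openin_imp_openin_kelleyfication:
  "openin X U \<Longrightarrow> openin (kelleyfication X) U"
  by (meson openin_continuous_map_preimage openin_kelleyfication openin_subset)

lemma topspace_kelleyfication [simp]: "topspace (kelleyfication X) = topspace X"
proof
  show "topspace (kelleyfication X) \<subseteq> topspace X"
    by (meson openin_kelleyfication openin_topspace)
  show "topspace X \<subseteq> topspace (kelleyfication X)"
    by (meson openin_imp_openin_kelleyfication openin_subset openin_topspace)
qed

lemma continuous_map_simplex_kelleyfication:
  "continuous_map (simplex p) (kelleyfication X) f \<longleftrightarrow> continuous_map (simplex p) X f"
  unfolding continuous_map_def topspace_kelleyfication
proof safe
  fix U
  assume "\<forall>U. openin (kelleyfication X) U \<longrightarrow>
      openin (simplex p) {x \<in> topspace (simplex p). f x \<in> U}" and "openin X U"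
  then show "openin (simplex p) {x \<in> topspace (simplex p). f x \<in> U}"
    using openin_imp_openin_kelleyfication by blast
next
  fix U
  assume f: "f \<in> topspace (simplex p) \<rightarrow> topspace X"
    "\<forall>U. openin X U \<longrightarrow> openin (simplex p) {x \<in> topspace (simplex p). f x \<in> U}"
    and U: "openin (kelleyfication X) U"
  have "continuous_map (simplex p) X f"
    using f by (simp only: continuous_map_def simp_thms)
  then show "openin (simplex p) {x \<in> topspace (simplex p). f x \<in> U}"
    using U by (simp only: openin_kelleyfication simp_thms)
qed

lemma delta_generated_kelleyfication: "delta_generated (kelleyfication X)"
  by (simp add: delta_generated_def openin_kelleyfication[of X]
      continuous_map_simplex_kelleyfication)

lemma continuous_map_into_kelleyfication:
  assumes "delta_generated Z"
  shows "continuous_map Z (kelleyfication X) f \<longleftrightarrow> continuous_map Z X f"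
proof
  assume "continuous_map Z (kelleyfication X) f"
  then show "continuous_map Z X f"
    by (auto simp: continuous_map_def dest: openin_imp_openin_kelleyfication)
next
  assume f: "continuous_map Z X f"
  have "openin Z {z \<in> topspace Z. f z \<in> U}" if U: "openin (kelleyfication X) U" for U
  proof -
    have "openin (simplex p) {x \<in> topspace (simplex p). g x \<in> {z \<in> topspace Z. f z \<in> U}}"
      if g: "continuous_map (simplex p) Z g" for p g
    proof -
      have "continuous_map (simplex p) X (f \<circ> g)"
        using g f continuous_map_compose by blast
      then have "openin (simplex p) {x \<in> topspace (simplex p). (f \<circ> g) x \<in> U}"
        by (rule U[unfolded openin_kelleyfication, THEN conjunct2, rule_format])
      moreover have "{x \<in> topspace (simplex p). (f \<circ> g) x \<in> U} =
          {x \<in> topspace (simplex p). g x \<in> {z \<in> topspace Z. f z \<in> U}}"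
        using continuous_map_image_subset_topspace[OF g] by auto
      ultimately show ?thesis by (simp only:)
    qed
    then show ?thesis
      by (intro assms[unfolded delta_generated_def, rule_format]) auto
  qed
  then show "continuous_map Z (kelleyfication X) f"
    using f by (auto simp: continuous_map_def)
qed

lemma quotient_of_simplices_imp_delta_generated:
  assumes q: "quotient_map (sum_topology (\<lambda>i. simplex (n i)) I) X q"
  shows "delta_generated X"
  unfolding delta_generated_def
proof (intro allI impI)
  fix U
  assume U: "U \<subseteq> topspace X"
    and op: "\<forall>p f. continuous_map (simplex p) X f \<longrightarrow>
           openin (simplex p) {x \<in> topspace (simplex p). f x \<in> U}"
  let ?S = "sum_topology (\<lambda>i. simplex (n i)) I"
  have "openin (simplex (n i)) {x. (i, x) \<in> {y \<in> topspace ?S. q y \<in> U}}" if i: "i \<in> I" for i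
  proof -
    have "continuous_map (simplex (n i)) ?S (\<lambda>x. (i, x))"
      using continuous_map_component_injection[OF i, of "\<lambda>i. simplex (n i)"] by simp
    then have "continuous_map (simplex (n i)) X (q \<circ> (\<lambda>x. (i, x)))"
      using continuous_map_compose quotient_imp_continuous_map[OF q] by blast
    then have "openin (simplex (n i)) {x \<in> topspace (simplex (n i)). (q \<circ> (\<lambda>x. (i, x))) x \<in> U}"
      using op by blast
    moreover have "{x \<in> topspace (simplex (n i)). (q \<circ> (\<lambda>x. (i, x))) x \<in> U} =
        {x. (i, x) \<in> {y \<in> topspace ?S. q y \<in> U}}"
      using i by auto
    ultimately show ?thesis by (simp only:)
  qed
  then have "openin ?S {y \<in> topspace ?S. q y \<in> U}"
    unfolding openin_sum_topology by auto
  then show "openin X U"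
    using q U unfolding quotient_map_def by blast
qed

lemma delta_generated_iff_quotient:
  fixes X :: "'a topology"
  shows "delta_generated X \<longleftrightarrow>
    (\<exists>(I :: (nat \<times> ((nat \<Rightarrow> real) \<Rightarrow> 'a)) set) n q.
       quotient_map (sum_topology (\<lambda>i. simplex (n i)) I) X q)"
proof
  assume X: "delta_generated X"
  define I where "I = {(p, f). continuous_map (simplex p) X f}"
  let ?S = "sum_topology (\<lambda>i. simplex (fst i)) I"
  let ?q = "\<lambda>(i :: nat \<times> ((nat \<Rightarrow> real) \<Rightarrow> 'a), x). snd i x"
  have "quotient_map ?S X ?q"
    unfolding quotient_map_def
  proof (intro conjI allI impI)
    show "?q ` topspace ?S = topspace X"
    proof
      show "?q ` topspace ?S \<subseteq> topspace X"
        by (fastforce simp: I_def continuous_map_def Pi_iff)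
      show "topspace X \<subseteq> ?q ` topspace ?S"
      proof
        fix a assume a: "a \<in> topspace X"
        have "(0, \<lambda>_. a) \<in> I"
          using a by (simp add: I_def)
        moreover have "(\<lambda>i. if i = 0 then 1 else 0) \<in> standard_simplex 0"
          by (simp add: standard_simplex_def)
        ultimately have "((0, \<lambda>_. a), (\<lambda>i. if i = 0 then 1 else 0)) \<in> topspace ?S"
          by simp
        then show "a \<in> ?q ` topspace ?S"
          by (rule rev_image_eqI) simp
      qed
    qed
    fix U assume U: "U \<subseteq> topspace X"
    have *: "{x. ((p, f), x) \<in> {y \<in> topspace ?S. ?q y \<in> U}} =
        {x \<in> topspace (simplex p). f x \<in> U}" if "(p, f) \<in> I" for p f
      using that by auto
    have "openin ?S {y \<in> topspace ?S. ?q y \<in> U} \<longleftrightarrow>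
        (\<forall>(p, f)\<in>I. openin (simplex p) {x \<in> topspace (simplex p). f x \<in> U})"
      unfolding openin_sum_topology using * by fastforce
    also have "\<dots> \<longleftrightarrow> openin X U"
    proof
      assume "\<forall>(p, f)\<in>I. openin (simplex p) {x \<in> topspace (simplex p). f x \<in> U}"
      then have "\<forall>p f. continuous_map (simplex p) X f \<longrightarrow>
          openin (simplex p) {x \<in> topspace (simplex p). f x \<in> U}"
        by (simp add: I_def)
      then show "openin X U"
        using X U unfolding delta_generated_def by blast
    next
      assume "openin X U"
      then show "\<forall>(p, f)\<in>I. openin (simplex p) {x \<in> topspace (simplex p). f x \<in> U}"
        using openin_continuous_map_preimage by (force simp: I_def)
    qed
    finally show "openin ?S {y \<in> topspace ?S. ?q y \<in> U} \<longleftrightarrow> openin X U" .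
  qed
  then show "\<exists>(I :: (nat \<times> ((nat \<Rightarrow> real) \<Rightarrow> 'a)) set) n q.
       quotient_map (sum_topology (\<lambda>i. simplex (n i)) I) X q"
    by blast
next
  assume "\<exists>(I :: (nat \<times> ((nat \<Rightarrow> real) \<Rightarrow> 'a)) set) n q.
       quotient_map (sum_topology (\<lambda>i. simplex (n i)) I) X q"
  then show "delta_generated X"
    using quotient_of_simplices_imp_delta_generated by blast
qed

text \<open>Size convention: the type \<open>'u\<close> plays the role of a universe. A set is small if it has fewer
  elements than \<open>'u\<close>, and the objects of Top are the Delta-generated topologies on small subsets
  of \<open>'u\<close>. If the cardinality of \<open>'u\<close> is strongly inaccessible, this is, up to equivalence, the
  category of all Delta-generated spaces in the corresponding Grothendieck universe.\<close>

definition small :: "'u itself \<Rightarrow> 'a set \<Rightarrow> bool" where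
  "small _ A \<longleftrightarrow> A \<prec> (UNIV :: 'u set)"

definition Top_space :: "'u topology \<Rightarrow> bool" where
  "Top_space X \<longleftrightarrow> delta_generated X \<and> small TYPE('u) (topspace X)"

abbreviation unit_interval :: "real topology" where
  "unit_interval \<equiv> top_of_set {0..1}"

definition compact_open_topology :: "'a topology \<Rightarrow> 'b topology \<Rightarrow> ('a \<Rightarrow> 'b) topology" where
  "compact_open_topology X Y = topology_generated_by
     {{f \<in> extensional (topspace X). continuous_map X Y f \<and> f ` K \<subseteq> U} | K U.
        compactin X K \<and> openin Y U}"

text \<open>The internal hom of Top.\<close>

definition TOP :: "'a topology \<Rightarrow> 'b topology \<Rightarrow> ('a \<Rightarrow> 'b) topology" where
  "TOP X Y = kelleyfication (compact_open_topology X Y)"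


section \<open>Fibrations and equivalences of spaces\<close>

definition disk :: "nat \<Rightarrow> (nat \<Rightarrow> real) topology" where
  "disk n = subtopology (Euclidean_space n) {x. (\<Sum>i<n. (x i)\<^sup>2) \<le> 1}"

definition disk_boundary :: "nat \<Rightarrow> (nat \<Rightarrow> real) set" where
  "disk_boundary n = {x \<in> topspace (disk n). (\<Sum>i<n. (x i)\<^sup>2) = 1}"

text \<open>Right lifting property of \<open>f : X \<rightarrow> Y\<close> with respect to the inclusion of \<open>Z \<times> {0}\<close> into
  \<open>Z \<times> [0,1]\<close>. As \<open>[0,1]\<close> is locally compact, for Delta-generated \<open>Z\<close> the usual product topology
  on \<open>Z \<times> [0,1]\<close> is Delta-generated, so that it is the product of Top; the same remark applies to
  the library notion of homotopy.\<close>

definition homotopy_lifting ::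
  "'z topology \<Rightarrow> 'a topology \<Rightarrow> 'b topology \<Rightarrow> ('a \<Rightarrow> 'b) \<Rightarrow> bool" where
  "homotopy_lifting Z X Y f \<longleftrightarrow>
     (\<forall>u v. continuous_map (subtopology (prod_topology Z unit_interval) (UNIV \<times> {0})) X u \<longrightarrow>
        continuous_map (prod_topology Z unit_interval) Y v \<longrightarrow>
        (\<forall>z\<in>topspace Z. f (u (z, 0)) = v (z, 0)) \<longrightarrow>
        (\<exists>l. continuous_map (prod_topology Z unit_interval) X l \<and>
           (\<forall>z\<in>topspace Z. l (z, 0) = u (z, 0)) \<and>
           (\<forall>z\<in>topspace Z. \<forall>t\<in>{0..1}. f (l (z, t)) = v (z, t))))"

definition q_fibration :: "'a topology \<Rightarrow> 'b topology \<Rightarrow> ('a \<Rightarrow> 'b) \<Rightarrow> bool" where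
  "q_fibration X Y f \<longleftrightarrow> continuous_map X Y f \<and> (\<forall>n. homotopy_lifting (disk n) X Y f)"

definition h_fibration ::
  "'u itself \<Rightarrow> 'a topology \<Rightarrow> 'b topology \<Rightarrow> ('a \<Rightarrow> 'b) \<Rightarrow> bool" where
  "h_fibration _ X Y f \<longleftrightarrow>
     continuous_map X Y f \<and> (\<forall>Z :: 'u topology. Top_space Z \<longrightarrow> homotopy_lifting Z X Y f)"

definition homotopy_equivalence :: "'a topology \<Rightarrow> 'b topology \<Rightarrow> ('a \<Rightarrow> 'b) \<Rightarrow> bool" where
  "homotopy_equivalence X Y f \<longleftrightarrow>
     continuous_map X Y f \<and>
     (\<exists>g. continuous_map Y X g \<and>
        homotopic_with (\<lambda>_. True) X X (g \<circ> f) id \<and>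
        homotopic_with (\<lambda>_. True) Y Y (f \<circ> g) id)"

text \<open>The n-th homotopy group of X at x consists of the homotopy classes of maps of pairs from
  the n-disk and its boundary to X and {x}. The group structure is not needed below: the map
  induced by a continuous map is a homomorphism for positive n, hence an isomorphism as soon as
  it is bijective.\<close>

definition disk_homotopy_class ::
  "nat \<Rightarrow> 'a topology \<Rightarrow> 'a \<Rightarrow> ((nat \<Rightarrow> real) \<Rightarrow> 'a) \<Rightarrow> ((nat \<Rightarrow> real) \<Rightarrow> 'a) set" where
  "disk_homotopy_class n X x g =
     {h. homotopic_with (\<lambda>k. \<forall>s\<in>disk_boundary n. k s = x) (disk n) X g h}"

definition homotopy_group ::
  "nat \<Rightarrow> 'a topology \<Rightarrow> 'a \<Rightarrow> ((nat \<Rightarrow> real) \<Rightarrow> 'a) set set" where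
  "homotopy_group n X x =
     disk_homotopy_class n X x `
       {g. continuous_map (disk n) X g \<and> (\<forall>s\<in>disk_boundary n. g s = x)}"

definition homotopy_group_map ::
  "nat \<Rightarrow> 'b topology \<Rightarrow> 'b \<Rightarrow> ('a \<Rightarrow> 'b) \<Rightarrow> ((nat \<Rightarrow> real) \<Rightarrow> 'a) set \<Rightarrow>
   ((nat \<Rightarrow> real) \<Rightarrow> 'b) set" where
  "homotopy_group_map n Y y f c = (\<Union>g\<in>c. disk_homotopy_class n Y y (f \<circ> g))"

definition path_components_map ::
  "'b topology \<Rightarrow> ('a \<Rightarrow> 'b) \<Rightarrow> 'a set \<Rightarrow> 'b set" where
  "path_components_map Y f c = (\<Union>x\<in>c. Collect (path_component_of Y (f x)))"

definition weak_homotopy_equivalence ::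
  "'a topology \<Rightarrow> 'b topology \<Rightarrow> ('a \<Rightarrow> 'b) \<Rightarrow> bool" where
  "weak_homotopy_equivalence X Y f \<longleftrightarrow>
     continuous_map X Y f \<and>
     bij_betw (path_components_map Y f) (path_components_of X) (path_components_of Y) \<and>
     (\<forall>n\<ge>1. \<forall>x\<in>topspace X.
        bij_betw (homotopy_group_map n Y (f x) f) (homotopy_group n X x) (homotopy_group n Y (f x)))"


section \<open>Multipointed d-spaces\<close>

text \<open>Maps defined on \<open>[0,1]\<close> or on the underlying space are represented by extensional functions
  (equal to \<open>undefined\<close> off the domain), so that equality of HOL functions is equality of maps.\<close>

definition reparametrizations :: "(real \<Rightarrow> real) set" where
  "reparametrizations =
     {\<phi>. homeomorphic_map unit_interval unit_interval \<phi> \<and> mono_on {0..1} \<phi>}"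

definition normalized_composition :: "(real \<Rightarrow> 'u) \<Rightarrow> (real \<Rightarrow> 'u) \<Rightarrow> real \<Rightarrow> 'u" where
  "normalized_composition \<gamma>\<^sub>1 \<gamma>\<^sub>2 =
     (\<lambda>t\<in>{0..1}. if t \<le> 1/2 then \<gamma>\<^sub>1 (2 * t) else \<gamma>\<^sub>2 (2 * t - 1))"

record 'u mdspace =
  underlying :: "'u topology"
  states :: "'u set"
  execution_paths :: "(real \<Rightarrow> 'u) set"

definition multipointed_dspace :: "'u mdspace \<Rightarrow> bool" where
  "multipointed_dspace X \<longleftrightarrow>
     Top_space (underlying X) \<and>
     states X \<subseteq> topspace (underlying X) \<and>
     (\<forall>\<gamma>\<in>execution_paths X. \<gamma> \<in> extensional {0..1} \<and> pathin (underlying X) \<gamma> \<and>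
        \<gamma> 0 \<in> states X \<and> \<gamma> 1 \<in> states X) \<and>
     (\<forall>\<gamma>\<in>execution_paths X. \<forall>\<phi>\<in>reparametrizations.
        compose {0..1} \<gamma> \<phi> \<in> execution_paths X) \<and>
     (\<forall>\<gamma>\<^sub>1\<in>execution_paths X. \<forall>\<gamma>\<^sub>2\<in>execution_paths X. \<gamma>\<^sub>1 1 = \<gamma>\<^sub>2 0 \<longrightarrow>
        normalized_composition \<gamma>\<^sub>1 \<gamma>\<^sub>2 \<in> execution_paths X)"

definition dspace_map :: "'u mdspace \<Rightarrow> 'u mdspace \<Rightarrow> ('u \<Rightarrow> 'u) \<Rightarrow> bool" where
  "dspace_map X Y f \<longleftrightarrow>
     f \<in> extensional (topspace (underlying X)) \<and>
     continuous_map (underlying X) (underlying Y) f \<and>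
     f ` states X \<subseteq> states Y \<and>
     (\<forall>\<gamma>\<in>execution_paths X. compose {0..1} f \<gamma> \<in> execution_paths Y)"

type_synonym 'u dspace_arrow = "'u mdspace \<times> ('u \<Rightarrow> 'u) \<times> 'u mdspace"

definition GdTop :: "('u mdspace, 'u dspace_arrow) cat" where
  "GdTop = \<lparr>
     Obj = {X. multipointed_dspace X},
     Arr = {(X, f, Y). multipointed_dspace X \<and> multipointed_dspace Y \<and> dspace_map X Y f},
     Dom = (\<lambda>(X, f, Y). X),
     Cod = (\<lambda>(X, f, Y). Y),
     Cmp = (\<lambda>(Y, g, Z) (X, f, Y'). (X, compose (topspace (underlying X)) g f, Z)),
     Idt = (\<lambda>X. (X, \<lambda>x\<in>topspace (underlying X). x, X))\<rparr>"

definition path_space :: "'u mdspace \<Rightarrow> 'u \<Rightarrow> 'u \<Rightarrow> (real \<Rightarrow> 'u) topology" where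
  "path_space X \<alpha> \<beta> = kelleyfication (subtopology (TOP unit_interval (underlying X))
     {\<gamma> \<in> execution_paths X. \<gamma> 0 = \<alpha> \<and> \<gamma> 1 = \<beta>})"

type_synonym 'u path_map_class =
  "(real \<Rightarrow> 'u) topology \<Rightarrow> (real \<Rightarrow> 'u) topology \<Rightarrow> ((real \<Rightarrow> 'u) \<Rightarrow> (real \<Rightarrow> 'u)) \<Rightarrow> bool"

definition on_path_spaces :: "'u path_map_class \<Rightarrow> 'u dspace_arrow \<Rightarrow> bool" where
  "on_path_spaces K = (\<lambda>(X, f, Y). \<forall>\<alpha>\<in>states X. \<forall>\<beta>\<in>states X.
     K (path_space X \<alpha> \<beta>) (path_space Y (f \<alpha>) (f \<beta>)) (compose {0..1} f))"

definition bijective_on_states :: "'u dspace_arrow \<Rightarrow> bool" where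
  "bijective_on_states = (\<lambda>(X, f, Y). bij_betw f (states X) (states Y))"

text \<open>The cofibrations of a model structure are determined by its weak equivalences and
  fibrations, so for given \<open>W\<close> and \<open>F\<close> at most one \<open>M\<close> satisfies this.\<close>

definition path_model_structure ::
  "'u path_map_class \<Rightarrow> 'u path_map_class \<Rightarrow> 'u dspace_arrow arrow_classes \<Rightarrow> bool" where
  "path_model_structure W F M \<longleftrightarrow>
     model_structure GdTop M \<and>
     Weq M = {f \<in> Arr GdTop. bijective_on_states f \<and> on_path_spaces W f} \<and>
     Fib M = {f \<in> Arr GdTop. on_path_spaces F f}"

definition q_model_structure :: "'u dspace_arrow arrow_classes \<Rightarrow> bool" where
  "q_model_structure = path_model_structure weak_homotopy_equivalence q_fibration"

definition h_model_structure :: "'u dspace_arrow arrow_classes \<Rightarrow> bool" where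
  "h_model_structure = path_model_structure homotopy_equivalence (h_fibration TYPE('u))"

definition m_model_structure :: "'u dspace_arrow arrow_classes \<Rightarrow> bool" where
  "m_model_structure = path_model_structure weak_homotopy_equivalence (h_fibration TYPE('u))"

lemma execution_pathD:
  assumes "multipointed_dspace X" "\<gamma> \<in> execution_paths X"
  shows "\<gamma> \<in> extensional {0..1}" and "\<gamma> \<in> {0..1} \<rightarrow> topspace (underlying X)"
proof -
  have "\<gamma> \<in> extensional {0..1} \<and> pathin (underlying X) \<gamma>"
    using assms(1)[unfolded multipointed_dspace_def, THEN conjunct2, THEN conjunct2, THEN conjunct1]
      assms(2) by blast
  then show "\<gamma> \<in> extensional {0..1}" and "\<gamma> \<in> {0..1} \<rightarrow> topspace (underlying X)"
    by (simp_all add: pathin_def continuous_map_def)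
qed

lemma states_subset: "multipointed_dspace X \<Longrightarrow> states X \<subseteq> topspace (underlying X)"
  unfolding multipointed_dspace_def by (elim conjE)

lemma is_category_GdTop: "is_category (GdTop :: ('u mdspace, 'u dspace_arrow) cat)"
proof -
  have id: "dspace_map X X (\<lambda>x\<in>topspace (underlying X). x)" if X: "multipointed_dspace X"
    for X :: "'u mdspace"
  proof -
    have "compose {0..1} (\<lambda>x\<in>topspace (underlying X). x) \<gamma> = \<gamma>"
      if "\<gamma> \<in> execution_paths X" for \<gamma>
      by (rule Id_compose[OF execution_pathD(2)[OF X that] execution_pathD(1)[OF X that]])
    moreover have "states X \<subseteq> topspace (underlying X)"
      by (rule states_subset[OF X])
    ultimately show ?thesis
      using continuous_map_eq[OF continuous_map_id, of "underlying X"]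
      by (auto simp: dspace_map_def)
  qed
  have cmp: "dspace_map X Z (compose (topspace (underlying X)) g f)"
    if X: "multipointed_dspace X" and f: "dspace_map X Y f" and g: "dspace_map Y Z g"
    for X Y Z :: "'u mdspace" and f g
  proof -
    have "compose {0..1} (compose (topspace (underlying X)) g f) \<gamma> =
        compose {0..1} g (compose {0..1} f \<gamma>)" if "\<gamma> \<in> execution_paths X" for \<gamma>
      by (rule compose_assoc[OF execution_pathD(2)[OF X that], symmetric])
    moreover have "continuous_map (underlying X) (underlying Z) (compose (topspace (underlying X)) g f)"
      using continuous_map_eq[OF continuous_map_compose[of "underlying X" "underlying Y" f "underlying Z" g],
          of "compose (topspace (underlying X)) g f"] f g
      by (auto simp: dspace_map_def compose_def)
    moreover have "compose (topspace (underlying X)) g f ` states X \<subseteq> states Z"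
      using states_subset[OF X] f g by (fastforce simp: dspace_map_def compose_def)
    ultimately show ?thesis
      using f g by (auto simp: dspace_map_def)
  qed
  have pi: "f \<in> topspace (underlying X) \<rightarrow> topspace (underlying Y)"
    "f \<in> extensional (topspace (underlying X))"
    if "dspace_map X Y f" for X Y :: "'u mdspace" and f
    using that by (auto simp: dspace_map_def continuous_map_def)
  have unit1: "compose (topspace (underlying X)) f (\<lambda>x\<in>topspace (underlying X). x) = f"
    and unit2: "compose (topspace (underlying X)) (\<lambda>x\<in>topspace (underlying Y). x) f = f"
    if "dspace_map X Y f" for X Y :: "'u mdspace" and f
    by (rule compose_Id[OF pi[OF that]], rule Id_compose[OF pi[OF that]])
  have assoc: "compose (topspace (underlying X)) h (compose (topspace (underlying X)) g f) =
      compose (topspace (underlying X)) (compose (topspace (underlying Y)) h g) f"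
    if "dspace_map X Y f" for X Y :: "'u mdspace" and f g h
    by (rule compose_assoc[OF pi(1)[OF that]])
  show ?thesis
    unfolding is_category_def Hom_def GdTop_def
    using id cmp unit1 unit2 assoc by auto
qed

end

theory Submission
  imports Defs
begin

text \<open>In a model structure the cofibrations are the maps with the left lifting property against
  the trivial fibrations, so fewer trivial fibrations mean more cofibrations. It therefore
  suffices to compare the classes of maps of spaces: h-fibrations are q-fibrations, because the
  disks are retracts of simplices and simplices have copies in the universe; and homotopy
  equivalences are weak homotopy equivalences. The second fact needs care with base points: if
  \<open>\<phi>\<close> is homotopic to the identity, then \<open>\<phi>\<close> acts on homotopy groups as transport along the track
  of the base point, which is bijective.\<close>

section \<open>Homotopies of disk maps along a path\<close>

definition radius :: "nat \<Rightarrow> (nat \<Rightarrow> real) \<Rightarrow> real" where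
  "radius n y = sqrt (\<Sum>i<n. (y i)\<^sup>2)"

text \<open>Dividing by the maximum with 1 fixes the disk and projects everything outside it onto
  the sphere without a case split. Coordinates from \<open>n\<close> on are erased, so the argument
  may be any sequence.\<close>

definition radial_retraction :: "nat \<Rightarrow> (nat \<Rightarrow> real) \<Rightarrow> nat \<Rightarrow> real" where
  "radial_retraction n y = (\<lambda>i. if i < n then y i / max 1 (radius n y) else 0)"

lemma radius_nonneg [simp]: "0 \<le> radius n y"
  by (simp add: radius_def sum_nonneg)

lemma radius_scale: "radius n (\<lambda>i. c * y i) = \<bar>c\<bar> * radius n y"
  by (simp add: radius_def power_mult_distrib real_sqrt_mult flip: sum_distrib_left)

lemma topspace_disk: "topspace (disk n) = {y. (\<forall>i\<ge>n. y i = 0) \<and> radius n y \<le> 1}"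
  by (auto simp: disk_def topspace_Euclidean_space radius_def)

lemma disk_boundary_eq: "disk_boundary n = {y. (\<forall>i\<ge>n. y i = 0) \<and> radius n y = 1}"
  by (auto simp: disk_boundary_def topspace_disk radius_def)

lemma disk_boundary_subset: "disk_boundary n \<subseteq> topspace (disk n)"
  by (auto simp: disk_boundary_def)

lemma radius_radial_retraction: "radius n (radial_retraction n y) = radius n y / max 1 (radius n y)"
proof -
  have "radius n (radial_retraction n y) = radius n (\<lambda>i. inverse (max 1 (radius n y)) * y i)"
    unfolding radius_def[of n "radial_retraction n y"] radius_def[of n "\<lambda>i. _ * y i"]
    by (simp add: radial_retraction_def divide_inverse mult.commute)
  then show ?thesis
    by (simp only: radius_scale) (simp add: field_simps)
qed

lemma radial_retraction_in_disk: "radial_retraction n y \<in> topspace (disk n)"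
proof -
  have "radius n y / max 1 (radius n y) \<le> 1"
    by (simp add: divide_le_eq)
  then show ?thesis
    using radius_radial_retraction[of n y] by (auto simp: topspace_disk radial_retraction_def)
qed

lemma radial_retraction_in_boundary:
  "1 \<le> radius n y \<Longrightarrow> radial_retraction n y \<in> disk_boundary n"
  using radius_radial_retraction[of n y] by (auto simp: disk_boundary_eq radial_retraction_def max_def)

lemma radial_retraction_id: "s \<in> topspace (disk n) \<Longrightarrow> radial_retraction n s = s"
  by (auto simp: topspace_disk radial_retraction_def max_def)

lemma continuous_map_radius:
  assumes "\<And>i. i < n \<Longrightarrow> continuous_map X euclideanreal (\<lambda>x. g x i)"
  shows "continuous_map X euclideanreal (\<lambda>x. radius n (g x))"
  unfolding radius_def using assms by (auto intro!: continuous_intros)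

text \<open>The denominator never vanishes, and only the first \<open>n\<close> coordinates of
  \<open>g\<close> enter the formula.\<close>

lemma continuous_map_radial_retraction:
  assumes "\<And>i. i < n \<Longrightarrow> continuous_map X euclideanreal (\<lambda>x. g x i)"
  shows "continuous_map X (disk n) (\<lambda>x. radial_retraction n (g x))"
proof -
  have "continuous_map X euclideanreal (\<lambda>x. radial_retraction n (g x) k)" for k
    unfolding radial_retraction_def
    using assms continuous_map_radius[OF assms]
    by (cases "k < n") (auto intro!: continuous_intros)
  then show ?thesis
    using radial_retraction_in_disk[of n]
    by (auto simp: disk_def Euclidean_space_def continuous_map_in_subtopology
        continuous_map_componentwise_UNIV topspace_Euclidean_space)
qed

lemma continuous_map_disk_coordinate: "continuous_map (disk n) euclideanreal (\<lambda>s. s i)"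
  unfolding disk_def Euclidean_space_def
  by (intro continuous_map_from_subtopology continuous_map_product_projection) simp

lemma continuous_map_cylinder_coordinate:
  "continuous_map (prod_topology unit_interval (disk n)) euclideanreal (\<lambda>z. snd z i)"
  using continuous_map_compose[OF continuous_map_snd continuous_map_disk_coordinate]
  by (simp add: o_def)

lemma continuous_map_cylinder_time:
  "continuous_map (prod_topology unit_interval Z) euclideanreal fst"
  using continuous_map_fst continuous_map_in_subtopology by blast

section \<open>Homotopies during which the boundary is collapsed to a moving point\<close>

abbreviation rel_homotopic ::
  "nat \<Rightarrow> 'a topology \<Rightarrow> 'a \<Rightarrow> ((nat \<Rightarrow> real) \<Rightarrow> 'a) \<Rightarrow> ((nat \<Rightarrow> real) \<Rightarrow> 'a) \<Rightarrow> bool" where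
  "rel_homotopic n X x \<equiv> homotopic_with (\<lambda>k. \<forall>s\<in>disk_boundary n. k s = x) (disk n) X"

text \<open>A constant \<open>p\<close> gives the relation behind
  \<open>disk_homotopy_class\<close>. A general \<open>p\<close> lets the base point move, as it
  does under a free homotopy of self-maps.\<close>

definition homotopy_along ::
  "nat \<Rightarrow> 'a topology \<Rightarrow> (real \<Rightarrow> 'a) \<Rightarrow> (real \<times> (nat \<Rightarrow> real) \<Rightarrow> 'a) \<Rightarrow> bool" where
  "homotopy_along n X p G \<longleftrightarrow>
     continuous_map (prod_topology unit_interval (disk n)) X G \<and>
     (\<forall>t\<in>{0..1}. \<forall>s\<in>disk_boundary n. G (t, s) = p t)"

lemma rel_homotopic_iff:
  "rel_homotopic n X x a b \<longleftrightarrow>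
     (\<exists>G. homotopy_along n X (\<lambda>_. x) G \<and>
        (\<forall>s\<in>topspace (disk n). G (0, s) = a s) \<and> (\<forall>s\<in>topspace (disk n). G (1, s) = b s))"
proof -
  have "rel_homotopic n X x a b \<longleftrightarrow>
      (\<exists>h. continuous_map (prod_topology unit_interval (disk n)) X h \<and>
        (\<forall>s\<in>topspace (disk n). h (0, s) = a s) \<and> (\<forall>s\<in>topspace (disk n). h (1, s) = b s) \<and>
        (\<forall>t\<in>{0..1}. \<forall>s\<in>disk_boundary n. h (t, s) = x))"
    \<comment> \<open>The side condition asks that the boundary property depend only on values on
      the disk; it does, since the boundary lies in the disk.\<close>
    by (rule homotopic_with) (metis disk_boundary_subset subsetD)
  then show ?thesis
    unfolding homotopy_along_def by blast
qed

lemma rel_homotopic_eqI: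
  assumes "continuous_map (disk n) X a" "\<And>s. s \<in> disk_boundary n \<Longrightarrow> a s = x"
    and "\<And>s. s \<in> topspace (disk n) \<Longrightarrow> a s = b s"
  shows "rel_homotopic n X x a b"
  using assms disk_boundary_subset by (intro homotopic_with_equal) (auto simp: subset_iff)

lemma homotopy_along_end:
  assumes "homotopy_along n X p G" "t \<in> {0..1}"
  shows "continuous_map (disk n) X (\<lambda>s. G (t, s))"
    and "s \<in> disk_boundary n \<Longrightarrow> G (t, s) = p t"
proof -
  have "continuous_map (disk n) X (G \<circ> Pair t)"
    using assms by (intro continuous_map_o_Pair[where X = unit_interval]) (auto simp: homotopy_along_def)
  then show "continuous_map (disk n) X (\<lambda>s. G (t, s))"
    by (simp add: o_def)
qed (use assms in \<open>auto simp: homotopy_along_def\<close>)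

lemma homotopy_along_reverse:
  assumes "homotopy_along n X p G"
  shows "homotopy_along n X (\<lambda>t. p (1 - t)) (\<lambda>(t, s). G (1 - t, s))"
proof -
  have "continuous_map (prod_topology unit_interval (disk n)) unit_interval (\<lambda>z. 1 - fst z)"
    by (auto simp: continuous_map_in_subtopology intro!: continuous_intros continuous_map_cylinder_time)
  then have "continuous_map (prod_topology unit_interval (disk n))
      (prod_topology unit_interval (disk n)) (\<lambda>z. (1 - fst z, snd z))"
    by (simp add: continuous_map_paired continuous_map_snd)
  from continuous_map_compose[OF this] show ?thesis
    using assms by (auto simp: homotopy_along_def o_def case_prod_unfold)
qed

text \<open>Outside the disk, the radial coordinate runs along \<open>p\<close>; \<open>max\<close> and \<open>min\<close> keep the argument of
  \<open>p\<close> in the unit interval, which makes that branch continuous everywhere.\<close>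

definition extend_along ::
  "nat \<Rightarrow> (real \<Rightarrow> 'a) \<Rightarrow> ((nat \<Rightarrow> real) \<Rightarrow> 'a) \<Rightarrow> (nat \<Rightarrow> real) \<Rightarrow> 'a" where
  "extend_along n p a y =
     (if radius n y \<le> 1 then a (radial_retraction n y) else p (max 0 (min 1 (radius n y - 1))))"

text \<open>The branches meet at radius 1, where the retracted point lies on the boundary and both
  values are \<open>p 0\<close>. The map \<open>a\<close> may vary with \<open>z\<close>, so that
  one gluing lemma serves both single maps and homotopies.\<close>

lemma continuous_map_extend_along:
  assumes p: "pathin X p"
    and g: "\<And>i. i < n \<Longrightarrow> continuous_map Z euclideanreal (\<lambda>z. g z i)"
    and a: "continuous_map Z X (\<lambda>z. a z (radial_retraction n (g z)))"
    and bd: "\<And>z s. z \<in> topspace Z \<Longrightarrow> s \<in> disk_boundary n \<Longrightarrow> a z s = p 0"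
  shows "continuous_map Z X (\<lambda>z. extend_along n p (a z) (g z))"
  unfolding extend_along_def
proof (rule continuous_map_cases_le)
  show r: "continuous_map Z euclideanreal (\<lambda>z. radius n (g z))"
    using g by (rule continuous_map_radius)
  have "continuous_map Z unit_interval (\<lambda>z. max 0 (min 1 (radius n (g z) - 1)))"
    using r by (auto simp: continuous_map_in_subtopology intro!: continuous_intros)
  then show "continuous_map (subtopology Z {z \<in> topspace Z. 1 \<le> radius n (g z)}) X
      (\<lambda>z. p (max 0 (min 1 (radius n (g z) - 1))))"
    using continuous_map_compose[of Z unit_interval _ X p] p
    by (intro continuous_map_from_subtopology) (simp add: pathin_def o_def)
  fix z assume "z \<in> topspace Z" "radius n (g z) = 1"
  then show "a z (radial_retraction n (g z)) = p (max 0 (min 1 (radius n (g z) - 1)))"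
    using bd radial_retraction_in_boundary[of n "g z"] by simp
qed (use a in \<open>auto intro: continuous_map_from_subtopology\<close>)

text \<open>The change of base point along \<open>p\<close>: after doubling, the inner half of the
  disk carries \<open>a\<close>, and the collar from radius 1/2 to 1 runs through \<open>p\<close>,
  so the boundary ends at \<open>p 1\<close>.\<close>

definition transport ::
  "nat \<Rightarrow> (real \<Rightarrow> 'a) \<Rightarrow> ((nat \<Rightarrow> real) \<Rightarrow> 'a) \<Rightarrow> (nat \<Rightarrow> real) \<Rightarrow> 'a" where
  "transport n p a s = extend_along n p a (\<lambda>i. 2 * s i)"

lemma continuous_map_scaled_cylinder:
  assumes "continuous_map unit_interval euclideanreal c"
  shows "continuous_map (prod_topology unit_interval (disk n)) euclideanreal (\<lambda>z. c (fst z) * snd z i)"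
  using continuous_map_compose[OF continuous_map_fst assms, of "disk n"]
  by (intro continuous_intros continuous_map_cylinder_coordinate) (simp add: o_def)

text \<open>The given homotopy is performed on the inner half while the collar stays as it is. Hence
  transport is well defined on classes.\<close>

lemma transport_rel_homotopic:
  assumes p: "pathin X p" and ab: "rel_homotopic n X (p 0) a b"
  shows "rel_homotopic n X (p 1) (transport n p a) (transport n p b)"
proof -
  obtain G where G: "homotopy_along n X (\<lambda>_. p 0) G"
    and G0: "\<And>s. s \<in> topspace (disk n) \<Longrightarrow> G (0, s) = a s"
    and G1: "\<And>s. s \<in> topspace (disk n) \<Longrightarrow> G (1, s) = b s"
    using ab unfolding rel_homotopic_iff by blast
  let ?Z = "prod_topology unit_interval (disk n)"
  let ?H = "\<lambda>z. extend_along n p (\<lambda>s. G (fst z, s)) (\<lambda>i. 2 * snd z i)"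
  have c: "continuous_map ?Z euclideanreal (\<lambda>z. 2 * snd z i)" for i
    by (intro continuous_intros continuous_map_cylinder_coordinate)
  have "continuous_map ?Z ?Z (\<lambda>z. (fst z, radial_retraction n (\<lambda>i. 2 * snd z i)))"
    using continuous_map_radial_retraction[OF c] by (simp add: continuous_map_paired continuous_map_fst)
  then have "continuous_map ?Z X (\<lambda>z. G (fst z, radial_retraction n (\<lambda>i. 2 * snd z i)))"
    using continuous_map_compose[of ?Z ?Z _ X G] G by (auto simp: homotopy_along_def o_def)
  then have "continuous_map ?Z X ?H"
    using G by (intro continuous_map_extend_along p c) (auto simp: homotopy_along_def)
  then have "homotopy_along n X (\<lambda>_. p 1) ?H"
    by (auto simp: homotopy_along_def extend_along_def radius_scale disk_boundary_eq)
  moreover have "?H (0, s) = transport n p a s" "?H (1, s) = transport n p b s" for s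
    by (auto simp: transport_def extend_along_def G0 G1 radial_retraction_in_disk)
  ultimately show ?thesis
    unfolding rel_homotopic_iff by blast
qed

text \<open>The scaling factor grows from 1 to 2. Points pushed out of the disk are retracted to its
  boundary, where \<open>a\<close> is constantly \<open>x\<close>.\<close>

lemma rel_homotopic_squash:
  assumes a: "continuous_map (disk n) X a" and bd: "\<And>s. s \<in> disk_boundary n \<Longrightarrow> a s = x"
  shows "rel_homotopic n X x a (\<lambda>s. a (radial_retraction n (\<lambda>i. 2 * s i)))"
proof -
  let ?Z = "prod_topology unit_interval (disk n)"
  let ?H = "\<lambda>z. a (radial_retraction n (\<lambda>i. (1 + fst z) * snd z i))"
  have "continuous_map ?Z euclideanreal (\<lambda>z. (1 + fst z) * snd z i)" for i
    by (intro continuous_map_scaled_cylinder continuous_intros) simp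
  from continuous_map_compose[OF continuous_map_radial_retraction[OF this] a]
  have "continuous_map ?Z X ?H"
    by (simp add: o_def)
  then have "homotopy_along n X (\<lambda>_. x) ?H"
    by (auto simp: homotopy_along_def disk_boundary_eq radius_scale
        intro!: bd radial_retraction_in_boundary)
  then show ?thesis
    unfolding rel_homotopic_iff
    by (intro exI[of _ ?H]) (auto simp: radial_retraction_id)
qed

text \<open>The collar is absorbed gradually: at stage \<open>t\<close> the inner half shows
  \<open>G\<close> at time \<open>t\<close>, and the collar only runs through the part of
  \<open>p\<close> from \<open>t\<close> to 1.\<close>

lemma transport_homotopy_along:
  assumes p: "pathin X p" and G: "homotopy_along n X p G"
  shows "rel_homotopic n X (p 1) (transport n p (\<lambda>s. G (0, s))) (\<lambda>s. G (1, s))"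
proof -
  let ?Z = "prod_topology unit_interval (disk n)"
  let ?\<rho> = "\<lambda>z. radial_retraction n (\<lambda>i. 2 * snd z i)"
  \<comment> \<open>Up to radius 1/2 this is the stage \<open>t\<close>. Beyond it
    \<open>?\<rho>\<close> lies on the boundary, where \<open>G\<close> depends on time alone, and
    the time \<open>2 * radius - 1\<close> reaches 1 at the boundary of the disk.\<close>
  let ?\<tau> = "\<lambda>z. max (fst z) (min 1 (2 * radius n (snd z) - 1))"
  let ?H = "\<lambda>z. G (?\<tau> z, ?\<rho> z)"
  have "continuous_map ?Z euclideanreal (\<lambda>z. 2 * snd z i)" for i
    by (intro continuous_intros continuous_map_cylinder_coordinate)
  note \<rho> = continuous_map_radial_retraction[OF this]
  have "continuous_map ?Z unit_interval ?\<tau>"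
    by (auto simp: continuous_map_in_subtopology intro!: continuous_intros continuous_map_radius
        continuous_map_cylinder_coordinate continuous_map_cylinder_time)
  with \<rho> have "continuous_map ?Z ?Z (\<lambda>z. (?\<tau> z, ?\<rho> z))"
    by (simp add: continuous_map_paired)
  from continuous_map_compose[OF this, of X G] have "continuous_map ?Z X ?H"
    using G by (simp add: homotopy_along_def o_def)
  then have "homotopy_along n X (\<lambda>_. p 1) ?H"
    using G radial_retraction_in_boundary
    by (auto simp: homotopy_along_def disk_boundary_eq radius_scale max_def)
  moreover have "?H (0, s) = transport n p (\<lambda>s. G (0, s)) s" for s
  proof (cases "2 * radius n s \<le> 1")
    case True
    then show ?thesis
      by (simp add: transport_def extend_along_def radius_scale max_def min_def)
  next
    case False
    then have "?\<rho> (0, s) \<in> disk_boundary n"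
      by (intro radial_retraction_in_boundary) (simp add: radius_scale)
    then show ?thesis
      using False G by (simp add: homotopy_along_def transport_def extend_along_def radius_scale)
  qed
  moreover have "?H (1, s) = G (1, radial_retraction n (\<lambda>i. 2 * s i))" for s
    by (simp add: max_def)
  ultimately have "rel_homotopic n X (p 1) (transport n p (\<lambda>s. G (0, s)))
      (\<lambda>s. G (1, radial_retraction n (\<lambda>i. 2 * s i)))"
    unfolding rel_homotopic_iff by blast
  \<comment> \<open>At stage 1 what remains is \<open>G\<close> at time 1 after doubling; the
    squashing homotopy removes the doubling.\<close>
  moreover have "rel_homotopic n X (p 1) (\<lambda>s. G (1, s)) (\<lambda>s. G (1, radial_retraction n (\<lambda>i. 2 * s i)))"
    using homotopy_along_end[OF G, of 1] by (intro rel_homotopic_squash) auto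
  ultimately show ?thesis
    using homotopic_with_trans homotopic_with_symD by blast
qed

text \<open>Each end is homotopic to the transport of its start along the same \<open>p\<close>, and
  transport respects relative homotopy.\<close>

lemma homotopy_along_unique:
  assumes p: "pathin X p" and G: "homotopy_along n X p G" and H: "homotopy_along n X p H"
    and 0: "rel_homotopic n X (p 0) (\<lambda>s. G (0, s)) (\<lambda>s. H (0, s))"
  shows "rel_homotopic n X (p 1) (\<lambda>s. G (1, s)) (\<lambda>s. H (1, s))"
  using transport_homotopy_along[OF p G, THEN homotopic_with_symD]
    transport_rel_homotopic[OF p 0] transport_homotopy_along[OF p H]
  by (rule homotopic_with_trans[OF homotopic_with_trans])

lemma pathin_reverse:
  assumes "pathin X p"
  shows "pathin X (\<lambda>t. p (1 - t))"
proof -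
  have "continuous_map unit_interval unit_interval (\<lambda>t. 1 - t)"
    by (auto simp: continuous_map_in_subtopology intro!: continuous_intros)
  from continuous_map_compose[OF this] assms show ?thesis
    by (auto simp: pathin_def o_def)
qed

text \<open>Reversing time exchanges start and end, so the end determines the start as well.\<close>

lemma homotopy_along_unique_reverse:
  assumes p: "pathin X p" and G: "homotopy_along n X p G" and H: "homotopy_along n X p H"
    and 1: "rel_homotopic n X (p 1) (\<lambda>s. G (1, s)) (\<lambda>s. H (1, s))"
  shows "rel_homotopic n X (p 0) (\<lambda>s. G (0, s)) (\<lambda>s. H (0, s))"
  using homotopy_along_unique[OF pathin_reverse[OF p] homotopy_along_reverse[OF G]
      homotopy_along_reverse[OF H]] 1 by simp

text \<open>This is homotopy extension from the boundary to the disk. At time \<open>t\<close> the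
  disk is enlarged by the factor \<open>1 + t\<close>, and the part beyond radius 1 follows
  \<open>p\<close> up to time \<open>t\<close>.\<close>

lemma homotopy_along_exists:
  assumes p: "pathin X p" and a: "continuous_map (disk n) X a"
    and bd: "\<And>s. s \<in> disk_boundary n \<Longrightarrow> a s = p 0"
  obtains G where "homotopy_along n X p G" "\<And>s. s \<in> topspace (disk n) \<Longrightarrow> G (0, s) = a s"
proof
  let ?Z = "prod_topology unit_interval (disk n)"
  let ?G = "\<lambda>z. extend_along n p a (\<lambda>i. (1 + fst z) * snd z i)"
  have c: "continuous_map ?Z euclideanreal (\<lambda>z. (1 + fst z) * snd z i)" for i
    by (intro continuous_map_scaled_cylinder continuous_intros) simp
  from continuous_map_compose[OF continuous_map_radial_retraction[OF c] a]
  have "continuous_map ?Z X ?G"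
    using bd by (intro continuous_map_extend_along p c) (simp_all add: o_def)
  \<comment> \<open>At \<open>t = 0\<close> the boundary has radius 1 and falls into the branch of
    \<open>a\<close>; there \<open>bd\<close> supplies the value \<open>p 0\<close>.\<close>
  moreover have "?G (t, s) = p t" if "t \<in> {0..1}" "s \<in> disk_boundary n" for t s
    using that radial_retraction_id[of s n] bd[of s]
    by (auto simp: extend_along_def disk_boundary_eq radius_scale topspace_disk)
  ultimately show "homotopy_along n X p ?G"
    by (simp add: homotopy_along_def)
  show "?G (0, s) = a s" if "s \<in> topspace (disk n)" for s
    using that radial_retraction_id[of s n] by (simp add: extend_along_def topspace_disk)
qed

section \<open>Homotopy equivalences are weak homotopy equivalences\<close>

text \<open>\<open>H\<close> deforms \<open>\<phi>\<close> to the identity and may move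
  \<open>x\<close>; its track is the path along which base points are changed. The equations at the
  two ends hold for every \<open>y\<close> of the type, as in the definition of
  \<open>homotopic_with\<close>.\<close>

context
  fixes X :: "'a topology" and \<phi> H x
  assumes H: "continuous_map (prod_topology unit_interval X) X H"
    and H0: "\<And>y. H (0, y) = \<phi> y" and H1: "\<And>y. H (1, y) = y"
    and x: "x \<in> topspace X"
begin

lemma track_pathin: "pathin X (\<lambda>t. H (t, x))"
  using continuous_map_compose[of unit_interval _ "\<lambda>t. (t, x)", OF _ H] x
  by (simp add: pathin_def o_def continuous_map_paired)

text \<open>Since \<open>a\<close> collapses the boundary to \<open>x\<close>, applying
  \<open>H\<close> moves the boundary along the track. The start is \<open>\<phi> \<circ> a\<close>
  and the end is \<open>a\<close>.\<close>

lemma track_homotopy_along: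
  assumes "continuous_map (disk n) X a" "\<And>s. s \<in> disk_boundary n \<Longrightarrow> a s = x"
  shows "homotopy_along n X (\<lambda>t. H (t, x)) (\<lambda>(t, s). H (t, a s))"
proof -
  have "continuous_map (prod_topology unit_interval (disk n)) X (a \<circ> snd)"
    using continuous_map_snd assms(1) by (rule continuous_map_compose)
  then have "continuous_map (prod_topology unit_interval (disk n)) (prod_topology unit_interval X)
      (\<lambda>z. (fst z, a (snd z)))"
    by (simp add: continuous_map_paired continuous_map_fst o_def)
  from continuous_map_compose[OF this H] show ?thesis
    using assms(2) by (simp add: homotopy_along_def o_def case_prod_unfold)
qed

text \<open>Injectivity of \<open>\<phi>\<close> on classes: \<open>\<phi> \<circ> a\<close> and
  \<open>\<phi> \<circ> b\<close> are the starts, \<open>a\<close> and \<open>b\<close> the ends, of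
  homotopies along the same track.\<close>

lemma homotopic_to_id_reflects:
  assumes a: "continuous_map (disk n) X a" "\<And>s. s \<in> disk_boundary n \<Longrightarrow> a s = x"
    and b: "continuous_map (disk n) X b" "\<And>s. s \<in> disk_boundary n \<Longrightarrow> b s = x"
    and ab: "rel_homotopic n X (\<phi> x) (\<phi> \<circ> a) (\<phi> \<circ> b)"
  shows "rel_homotopic n X x a b"
  using homotopy_along_unique[OF track_pathin track_homotopy_along[OF a] track_homotopy_along[OF b]] ab
  by (simp add: H0 H1 o_def)

text \<open>Surjectivity of \<open>\<phi>\<close> on classes: \<open>c\<close> is moved along the
  track, and \<open>a\<close> is where it ends. Then \<open>\<phi> \<circ> a\<close> and
  \<open>c\<close> start two homotopies along the track with the same end.\<close>

lemma homotopic_to_id_lifts: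
  assumes c: "continuous_map (disk n) X c" "\<And>s. s \<in> disk_boundary n \<Longrightarrow> c s = \<phi> x"
  obtains a where "continuous_map (disk n) X a" "\<And>s. s \<in> disk_boundary n \<Longrightarrow> a s = x"
    "rel_homotopic n X (\<phi> x) (\<phi> \<circ> a) c"
proof -
  obtain G where G: "homotopy_along n X (\<lambda>t. H (t, x)) G"
    and G0: "\<And>s. s \<in> topspace (disk n) \<Longrightarrow> G (0, s) = c s"
    using homotopy_along_exists[OF track_pathin, of n c] c by (auto simp: H0)
  define a where "a s = G (1, s)" for s
  have a: "continuous_map (disk n) X a" "\<And>s. s \<in> disk_boundary n \<Longrightarrow> a s = x"
    unfolding a_def using homotopy_along_end[OF G, of 1] by (auto simp: H1)
  have "rel_homotopic n X (\<phi> x) (\<phi> \<circ> a) (\<lambda>s. G (0, s))"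
    using homotopy_along_unique_reverse[OF track_pathin track_homotopy_along[OF a] G] a
    by (simp add: H0 H1 o_def flip: a_def)
  moreover have "rel_homotopic n X (\<phi> x) (\<lambda>s. G (0, s)) c"
    using homotopy_along_end[OF G, of 0] G0 by (intro rel_homotopic_eqI) (auto simp: H0)
  ultimately show thesis
    using that a homotopic_with_trans by blast
qed

end

section \<open>The induced maps on homotopy groups\<close>

lemma homotopic_to_idE:
  assumes "homotopic_with (\<lambda>_. True) X X \<phi> id"
  obtains H where "continuous_map (prod_topology unit_interval X) X H"
    "\<And>y. H (0, y) = \<phi> y" "\<And>y. H (1, y) = y"
  using assms unfolding homotopic_with_def id_apply by blast

lemma homotopy_equivalenceE:
  assumes "homotopy_equivalence X Y f"
  obtains g where "continuous_map X Y f" "continuous_map Y X g"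
    "homotopic_with (\<lambda>_. True) X X (g \<circ> f) id" "homotopic_with (\<lambda>_. True) Y Y (f \<circ> g) id"
  using assms unfolding homotopy_equivalence_def by blast

lemma disk_homotopy_class_eq_iff:
  assumes "continuous_map (disk n) X b" "\<And>s. s \<in> disk_boundary n \<Longrightarrow> b s = x"
  shows "disk_homotopy_class n X x a = disk_homotopy_class n X x b \<longleftrightarrow> rel_homotopic n X x a b"
proof
  have "b \<in> disk_homotopy_class n X x b"
    using assms by (simp add: disk_homotopy_class_def)
  then show "rel_homotopic n X x a b"
    if "disk_homotopy_class n X x a = disk_homotopy_class n X x b"
    using that by (auto simp: disk_homotopy_class_def)
qed (auto simp: disk_homotopy_class_def intro: homotopic_with_trans homotopic_with_symD)

lemma rel_homotopic_compose:
  assumes "continuous_map X Y f" "rel_homotopic n X x a b"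
  shows "rel_homotopic n Y (f x) (f \<circ> a) (f \<circ> b)"
  using assms by (auto intro: homotopic_with_compose_continuous_map_left)

text \<open>\<open>homotopy_group_map\<close> takes a union over all representatives. The classes in
  this union coincide, and \<open>a\<close> itself contributes one of them.\<close>

lemma homotopy_group_map_class:
  assumes f: "continuous_map X Y f"
    and a: "continuous_map (disk n) X a" "\<And>s. s \<in> disk_boundary n \<Longrightarrow> a s = x"
  shows "homotopy_group_map n Y (f x) f (disk_homotopy_class n X x a) =
    disk_homotopy_class n Y (f x) (f \<circ> a)"
proof -
  have "disk_homotopy_class n Y (f x) (f \<circ> b) = disk_homotopy_class n Y (f x) (f \<circ> a)"
    if "b \<in> disk_homotopy_class n X x a" for b
  proof -
    have "rel_homotopic n Y (f x) (f \<circ> b) (f \<circ> a)"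
      using that f by (auto simp: disk_homotopy_class_def intro: rel_homotopic_compose homotopic_with_symD)
    then show ?thesis
      using continuous_map_compose[OF a(1) f] a(2) by (subst disk_homotopy_class_eq_iff) auto
  qed
  moreover have "a \<in> disk_homotopy_class n X x a"
    using a by (simp add: disk_homotopy_class_def)
  ultimately show ?thesis
    unfolding homotopy_group_map_def by blast
qed

text \<open>Injectivity comes from that of \<open>g \<circ> f\<close>. For surjectivity,
  \<open>g \<circ> c\<close> is lifted through \<open>g \<circ> f\<close> to a map \<open>a\<close>,
  and injectivity of \<open>f \<circ> g\<close> identifies \<open>f \<circ> a\<close> with
  \<open>c\<close>.\<close>

lemma bij_betw_homotopy_group_map:
  assumes "homotopy_equivalence X Y f" and x: "x \<in> topspace X"
  shows "bij_betw (homotopy_group_map n Y (f x) f) (homotopy_group n X x) (homotopy_group n Y (f x))"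
proof -
  obtain g where f: "continuous_map X Y f" and g: "continuous_map Y X g"
    and gf: "homotopic_with (\<lambda>_. True) X X (g \<circ> f) id"
    and fg: "homotopic_with (\<lambda>_. True) Y Y (f \<circ> g) id"
    using assms(1) by (rule homotopy_equivalenceE)
  obtain H where H: "continuous_map (prod_topology unit_interval X) X H"
    "\<And>y. H (0, y) = (g \<circ> f) y" "\<And>y. H (1, y) = y"
    using gf by (rule homotopic_to_idE) blast
  obtain K where K: "continuous_map (prod_topology unit_interval Y) Y K"
    "\<And>y. K (0, y) = (f \<circ> g) y" "\<And>y. K (1, y) = y"
    using fg by (rule homotopic_to_idE) blast
  have fx: "f x \<in> topspace Y"
    using f x by (auto simp: continuous_map_def)
  show ?thesis
    unfolding bij_betw_def
  proof
    show "inj_on (homotopy_group_map n Y (f x) f) (homotopy_group n X x)"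
    proof (rule inj_onI)
      fix A B
      assume "A \<in> homotopy_group n X x" "B \<in> homotopy_group n X x"
        and eq: "homotopy_group_map n Y (f x) f A = homotopy_group_map n Y (f x) f B"
      then obtain a b where a: "continuous_map (disk n) X a" "\<And>s. s \<in> disk_boundary n \<Longrightarrow> a s = x"
        and A: "A = disk_homotopy_class n X x a"
        and b: "continuous_map (disk n) X b" "\<And>s. s \<in> disk_boundary n \<Longrightarrow> b s = x"
        and B: "B = disk_homotopy_class n X x b"
        unfolding homotopy_group_def by blast
      have "rel_homotopic n Y (f x) (f \<circ> a) (f \<circ> b)"
        using eq continuous_map_compose[OF b(1) f] b(2)
        by (simp add: A B homotopy_group_map_class[OF f a] homotopy_group_map_class[OF f b]
            disk_homotopy_class_eq_iff)
      then have "rel_homotopic n X ((g \<circ> f) x) ((g \<circ> f) \<circ> a) ((g \<circ> f) \<circ> b)"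
        using rel_homotopic_compose[OF g] by (fastforce simp: o_assoc)
      then have "rel_homotopic n X x a b"
        using homotopic_to_id_reflects[OF H x, of n a b] a b by blast
      then show "A = B"
        unfolding A B by (subst disk_homotopy_class_eq_iff[OF b])
    qed
    show "homotopy_group_map n Y (f x) f ` homotopy_group n X x = homotopy_group n Y (f x)"
    proof
      show "homotopy_group_map n Y (f x) f ` homotopy_group n X x \<subseteq> homotopy_group n Y (f x)"
      proof
        fix C assume "C \<in> homotopy_group_map n Y (f x) f ` homotopy_group n X x"
        then obtain a where a: "continuous_map (disk n) X a" "\<And>s. s \<in> disk_boundary n \<Longrightarrow> a s = x"
          and C: "C = homotopy_group_map n Y (f x) f (disk_homotopy_class n X x a)"
          unfolding homotopy_group_def by blast
        show "C \<in> homotopy_group n Y (f x)"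
          using continuous_map_compose[OF a(1) f] a(2)
          by (simp add: C homotopy_group_map_class[OF f a] homotopy_group_def)
      qed
      show "homotopy_group n Y (f x) \<subseteq> homotopy_group_map n Y (f x) f ` homotopy_group n X x"
      proof
        fix C assume "C \<in> homotopy_group n Y (f x)"
        then obtain c where c: "continuous_map (disk n) Y c" "\<And>s. s \<in> disk_boundary n \<Longrightarrow> c s = f x"
          and C: "C = disk_homotopy_class n Y (f x) c"
          unfolding homotopy_group_def by blast
        \<comment> \<open>The map \<open>g \<circ> c\<close> is based at
          \<open>(g \<circ> f) x\<close>, in general not at \<open>x\<close>; this is the base point
          that lifting along the track of \<open>x\<close> expects.\<close>
        have gc: "continuous_map (disk n) X (g \<circ> c)" "\<And>s. s \<in> disk_boundary n \<Longrightarrow> (g \<circ> c) s = (g \<circ> f) x"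
          using continuous_map_compose[OF c(1) g] c(2) by auto
        obtain a where a: "continuous_map (disk n) X a" "\<And>s. s \<in> disk_boundary n \<Longrightarrow> a s = x"
          and ac: "rel_homotopic n X ((g \<circ> f) x) ((g \<circ> f) \<circ> a) (g \<circ> c)"
          using homotopic_to_id_lifts[OF H x gc] by blast
        have fa: "continuous_map (disk n) Y (f \<circ> a)" "\<And>s. s \<in> disk_boundary n \<Longrightarrow> (f \<circ> a) s = f x"
          using continuous_map_compose[OF a(1) f] a(2) by auto
        \<comment> \<open>After applying \<open>f\<close> and reassociating, both maps are
          composites with \<open>f \<circ> g\<close>, to which reflection along \<open>K\<close>
          applies.\<close>
        have "rel_homotopic n Y ((f \<circ> g) (f x)) ((f \<circ> g) \<circ> (f \<circ> a)) ((f \<circ> g) \<circ> c)"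
          using rel_homotopic_compose[OF f ac] by (simp add: o_assoc)
        then have "rel_homotopic n Y (f x) (f \<circ> a) c"
          using homotopic_to_id_reflects[OF K fx, of n "f \<circ> a" c] fa c by blast
        then have "C = homotopy_group_map n Y (f x) f (disk_homotopy_class n X x a)"
          using fa by (simp add: C homotopy_group_map_class[OF f a] disk_homotopy_class_eq_iff
              homotopic_with_symD)
        then show "C \<in> homotopy_group_map n Y (f x) f ` homotopy_group n X x"
          using a unfolding homotopy_group_def by blast
      qed
    qed
  qed
qed

section \<open>The induced map on path components\<close>

lemma path_component_homotopic_to_id:
  assumes "homotopic_with (\<lambda>_. True) X X \<phi> id" "x \<in> topspace X"
  shows "path_component_of X (\<phi> x) x"
proof -
  obtain H where H: "continuous_map (prod_topology unit_interval X) X H"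
    "\<And>y. H (0, y) = \<phi> y" "\<And>y. H (1, y) = y"
    using assms(1) by (rule homotopic_to_idE) blast
  then show ?thesis
    using track_pathin[OF H assms(2)] unfolding path_component_of_def by auto
qed

lemma path_components_map_class:
  assumes f: "continuous_map X Y f" and x: "x \<in> topspace X"
  shows "path_components_map Y f (path_component_of_set X x) = path_component_of_set Y (f x)"
proof -
  have "path_component_of_set Y (f y) = path_component_of_set Y (f x)" if "path_component_of X x y" for y
    by (metis f path_component_in_topspace path_component_of_continuous_image path_component_of_eq that)
  moreover have "path_component_of X x x"
    using x by (simp add: path_component_of_refl)
  ultimately show ?thesis
    unfolding path_components_map_def by blast
qed

lemma bij_betw_path_components_map:
  assumes "homotopy_equivalence X Y f"
  shows "bij_betw (path_components_map Y f) (path_components_of X) (path_components_of Y)"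
proof -
  obtain g where f: "continuous_map X Y f" and g: "continuous_map Y X g"
    and gf: "homotopic_with (\<lambda>_. True) X X (g \<circ> f) id"
    and fg: "homotopic_with (\<lambda>_. True) Y Y (f \<circ> g) id"
    using assms by (rule homotopy_equivalenceE)
  have fX: "f x \<in> topspace Y" if "x \<in> topspace X" for x
    using f that by (auto simp: continuous_map_def)
  have gY: "g y \<in> topspace X" if "y \<in> topspace Y" for y
    using g that by (auto simp: continuous_map_def)
  show ?thesis
  proof (rule bij_betwI')
    fix A B assume "A \<in> path_components_of X" "B \<in> path_components_of X"
    then obtain x y where x: "x \<in> topspace X" and A: "A = path_component_of_set X x"
      and y: "y \<in> topspace X" and B: "B = path_component_of_set X y"
      by (auto simp: path_components_of_def)
    have "path_component_of X x y" if "path_component_of Y (f x) (f y)"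
      using path_component_of_continuous_image[OF g that]
        path_component_homotopic_to_id[OF gf x] path_component_homotopic_to_id[OF gf y]
      by (metis comp_apply path_component_of_sym path_component_of_trans)
    then have "path_component_of Y (f x) (f y) \<longleftrightarrow> path_component_of X x y"
      using path_component_of_continuous_image[OF f] by blast
    then have "path_component_of Y (f x) = path_component_of Y (f y) \<longleftrightarrow>
        path_component_of X x = path_component_of X y"
      using x y fX by (auto simp: path_component_of_eq)
    then show "path_components_map Y f A = path_components_map Y f B \<longleftrightarrow> A = B"
      unfolding A B path_components_map_class[OF f x] path_components_map_class[OF f y]
      by (metis Collect_inj)
  next
    fix A assume "A \<in> path_components_of X"
    then show "path_components_map Y f A \<in> path_components_of Y"
      using path_components_map_class[OF f] fX by (auto simp: path_components_of_def)
  next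
    fix B assume "B \<in> path_components_of Y"
    then obtain y where y: "y \<in> topspace Y" and B: "B = path_component_of_set Y y"
      by (auto simp: path_components_of_def)
    \<comment> \<open>The component of \<open>g y\<close> is the preimage sought: the track of
      \<open>y\<close> joins \<open>f (g y)\<close> to \<open>y\<close>.\<close>
    have "path_component_of Y (f (g y)) = path_component_of Y y"
      using path_component_homotopic_to_id[OF fg y] y gY fX by (auto simp: path_component_of_eq)
    then have "B = path_components_map Y f (path_component_of_set X (g y))"
      unfolding B path_components_map_class[OF f gY[OF y]] by simp
    then show "\<exists>A\<in>path_components_of X. B = path_components_map Y f A"
      using gY[OF y] by (auto simp: path_components_of_def)
  qed
qed

theorem homotopy_equivalence_imp_weak:
  "homotopy_equivalence X Y f \<Longrightarrow> weak_homotopy_equivalence X Y f"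
  unfolding weak_homotopy_equivalence_def
  by (blast elim: homotopy_equivalenceE intro: bij_betw_homotopy_group_map bij_betw_path_components_map)

section \<open>Hurewicz fibrations are Serre fibrations\<close>

text \<open>A lifting problem over \<open>W\<close> is pulled back along \<open>d\<close>, solved
  over \<open>Z\<close>, and the solution restricted along \<open>e\<close>; \<open>d\<close> after
  \<open>e\<close> being the identity returns the original data.\<close>

lemma homotopy_lifting_retract:
  assumes lift: "homotopy_lifting Z X Y f"
    and e: "continuous_map W Z e" and d: "continuous_map Z W d"
    and de: "\<And>w. w \<in> topspace W \<Longrightarrow> d (e w) = w"
  shows "homotopy_lifting W X Y f"
  unfolding homotopy_lifting_def
proof (intro allI impI)
  fix u v
  assume u: "continuous_map (subtopology (prod_topology W unit_interval) (UNIV \<times> {0})) X u"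
    and v: "continuous_map (prod_topology W unit_interval) Y v"
    and uv: "\<forall>w\<in>topspace W. f (u (w, 0)) = v (w, 0)"
  \<comment> \<open>Stated for arbitrary spaces because it is applied in both directions, to
    \<open>d\<close> and to \<open>e\<close>.\<close>
  have prod: "continuous_map (prod_topology A unit_interval) (prod_topology B unit_interval)
      (\<lambda>z. (h (fst z), snd z))" if "continuous_map A B h" for A :: "'x topology" and B :: "'y topology" and h
    using continuous_map_compose[OF continuous_map_fst that]
    by (simp add: continuous_map_paired continuous_map_snd o_def)
  let ?d = "\<lambda>z. (d (fst z), snd z)" and ?e = "\<lambda>z. (e (fst z), snd z)"
  have "continuous_map (subtopology (prod_topology Z unit_interval) (UNIV \<times> {0}))
      (subtopology (prod_topology W unit_interval) (UNIV \<times> {0})) ?d"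
    using prod[OF d] by (auto simp: continuous_map_in_subtopology intro: continuous_map_from_subtopology)
  from continuous_map_compose[OF this u]
  have u': "continuous_map (subtopology (prod_topology Z unit_interval) (UNIV \<times> {0})) X (u \<circ> ?d)" .
  have v': "continuous_map (prod_topology Z unit_interval) Y (v \<circ> ?d)"
    using prod[OF d] v by (rule continuous_map_compose)
  have dW: "d z \<in> topspace W" if "z \<in> topspace Z" for z
    using d that by (auto simp: continuous_map_def)
  have eZ: "e w \<in> topspace Z" if "w \<in> topspace W" for w
    using e that by (auto simp: continuous_map_def)
  have "\<forall>z\<in>topspace Z. f ((u \<circ> ?d) (z, 0)) = (v \<circ> ?d) (z, 0)"
    using uv dW by simp
  then obtain l where l: "continuous_map (prod_topology Z unit_interval) X l"
    "\<forall>z\<in>topspace Z. l (z, 0) = (u \<circ> ?d) (z, 0)"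
    "\<forall>z\<in>topspace Z. \<forall>t\<in>{0..1}. f (l (z, t)) = (v \<circ> ?d) (z, t)"
    using lift u' v' unfolding homotopy_lifting_def by blast
  have "continuous_map (prod_topology W unit_interval) X (l \<circ> ?e)"
    using prod[OF e] l(1) by (rule continuous_map_compose)
  then show "\<exists>l. continuous_map (prod_topology W unit_interval) X l \<and>
      (\<forall>w\<in>topspace W. l (w, 0) = u (w, 0)) \<and>
      (\<forall>w\<in>topspace W. \<forall>t\<in>{0..1}. f (l (w, t)) = v (w, t))"
    using l(2,3) eZ de by (intro exI[of _ "l \<circ> ?e"]) simp
qed

text \<open>The scaling in \<open>e\<close> keeps the first \<open>n\<close> barycentric coordinates at most \<open>1 / (n + 1)\<close>, which
  leaves room for the last one; \<open>d\<close> undoes the scaling and then pushes into the disk.\<close>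

lemma disk_retract_of_simplex:
  obtains e d where "continuous_map (disk n) (simplex n) e" "continuous_map (simplex n) (disk n) d"
    "\<And>s. s \<in> topspace (disk n) \<Longrightarrow> d (e s) = s"
proof
  define b where "b s i = (s i + 1) / (2 * (real n + 1))" for s :: "nat \<Rightarrow> real" and i
  define e where "e s = (\<lambda>i. if i < n then b s i else if i = n then 1 - (\<Sum>j<n. b s j) else 0)" for s
  define d where "d y = radial_retraction n (\<lambda>i. 2 * (real n + 1) * y i - 1)" for y
  have abs: "\<bar>s i\<bar> \<le> 1" if "s \<in> topspace (disk n)" "i < n" for s i
  proof -
    have "(s i)\<^sup>2 \<le> (\<Sum>i<n. (s i)\<^sup>2)"
      using that(2) by (intro member_le_sum) auto
    also have "\<dots> \<le> 1"
      using that(1) by (simp add: topspace_disk radius_def)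
    finally show ?thesis
      by (simp add: abs_square_le_1)
  qed
  have b: "0 \<le> b s i" "b s i \<le> 1 / (real n + 1)" if "s \<in> topspace (disk n)" "i < n" for s i
  proof -
    show "0 \<le> b s i"
      unfolding b_def using abs[OF that] by (intro divide_nonneg_nonneg) auto
    have "b s i \<le> 2 / (2 * (real n + 1))"
      unfolding b_def using abs[OF that] by (intro divide_right_mono) auto
    also have "\<dots> = 1 / (real n + 1)"
      by (simp add: divide_simps)
    finally show "b s i \<le> 1 / (real n + 1)" .
  qed
  have "e s \<in> standard_simplex n" if s: "s \<in> topspace (disk n)" for s
  proof -
    have "(\<Sum>j<n. b s j) \<le> of_nat (card {..<n}) * (1 / (real n + 1))"
      using b[OF s] by (intro sum_bounded_above) auto
    also have "\<dots> \<le> 1"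
      by simp
    finally have le1: "(\<Sum>j<n. b s j) \<le> 1" .
    have "b s i \<le> 1" if "i < n" for i
    proof -
      have "1 / (real n + 1) \<le> 1"
        by simp
      with b(2)[OF s that] show ?thesis
        by (rule order_trans)
    qed
    moreover have "0 \<le> (\<Sum>j<n. b s j)"
      using b[OF s] by (intro sum_nonneg) auto
    moreover have "(\<Sum>i\<le>n. e s i) = 1"
      by (simp add: e_def lessThan_Suc_atMost[symmetric])
    ultimately show ?thesis
      using b[OF s] le1 by (auto simp: standard_simplex_def e_def)
  qed
  moreover have "continuous_map (disk n) euclideanreal (\<lambda>s. b s i)" for i
    unfolding b_def by (intro continuous_intros continuous_map_disk_coordinate) simp
  then have "continuous_map (disk n) euclideanreal (\<lambda>s. e s i)" for i
    unfolding e_def by (cases "i < n"; cases "i = n") (auto intro!: continuous_intros)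
  ultimately show "continuous_map (disk n) (simplex n) e"
    by (auto simp: continuous_map_in_subtopology continuous_map_componentwise_UNIV)
  have "continuous_map (simplex n) euclideanreal (\<lambda>y. 2 * (real n + 1) * y i - 1)" for i
    by (intro continuous_intros continuous_map_from_subtopology continuous_map_product_projection) simp_all
  then show "continuous_map (simplex n) (disk n) d"
    unfolding d_def by (intro continuous_map_radial_retraction)
  fix s assume s: "s \<in> topspace (disk n)"
  \<comment> \<open>In \<open>d (e s)\<close> the retraction is applied to a sequence known to agree
    with \<open>s\<close> only below \<open>n\<close>; it reads no other coordinate.\<close>
  have cong: "radial_retraction n y = radial_retraction n s" if "\<And>i. i < n \<Longrightarrow> y i = s i" for y
    using that by (simp add: radial_retraction_def radius_def cong: if_cong)
  have "2 * (real n + 1) * e s i - 1 = s i" if "i < n" for i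
  proof -
    have "0 < 2 * (real n + 1)"
      by simp
    then have "2 * (real n + 1) \<noteq> 0"
      by (rule less_imp_neq[THEN not_sym])
    then have "2 * (real n + 1) * b s i = s i + 1"
      unfolding b_def times_divide_eq_right by (rule nonzero_mult_div_cancel_left)
    then show ?thesis
      using that by (simp add: e_def)
  qed
  then have "d (e s) = radial_retraction n s"
    unfolding d_def by (rule cong)
  then show "d (e s) = s"
    using s by (simp add: radial_retraction_id)
qed

section \<open>Copies of the simplices inside the universe\<close>

lemma finitely_supported_lepoll_real: "{x :: nat \<Rightarrow> real. \<forall>i\<ge>n. x i = 0} \<lesssim> (UNIV :: real set)"
proof (induction n)
  case 0
  have "{x :: nat \<Rightarrow> real. \<forall>i\<ge>0. x i = 0} \<subseteq> {\<lambda>_. 0}"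
    by auto
  then have "{x :: nat \<Rightarrow> real. \<forall>i\<ge>0. x i = 0} \<lesssim> {\<lambda>_ :: nat. 0 :: real}"
    by (rule subset_imp_lepoll)
  also have "{\<lambda>_ :: nat. 0 :: real} \<lesssim> (UNIV :: real set)"
    by (rule finite_lepoll_infinite) (simp_all add: infinite_UNIV_char_0)
  finally show ?case .
next
  case (Suc n)
  let ?E = "\<lambda>n. {x :: nat \<Rightarrow> real. \<forall>i\<ge>n. x i = 0}"
  \<comment> \<open>Coordinate \<open>n\<close> is recorded separately and reset to 0, which leaves
    a sequence covered by the induction hypothesis. The extra real factor is absorbed by the square
    of the reals being equipollent to the reals.\<close>
  have "inj_on (\<lambda>x. (x(n := 0), x n)) (?E (Suc n))"
  proof (rule inj_onI)
    fix x y :: "nat \<Rightarrow> real"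
    assume "(x(n := 0), x n) = (y(n := 0), y n)"
    then show "x = y"
      by (metis fun_upd_triv fun_upd_upd prod.inject)
  qed
  moreover have "(\<lambda>x. (x(n := 0), x n)) ` ?E (Suc n) \<subseteq> ?E n \<times> UNIV"
    by auto
  ultimately have "?E (Suc n) \<lesssim> ?E n \<times> (UNIV :: real set)"
    unfolding lepoll_def by blast
  also have "\<dots> \<lesssim> (UNIV :: real set) \<times> (UNIV :: real set)"
    using Suc by (intro times_lepoll_mono) auto
  also have "\<dots> \<approx> (UNIV :: real set)"
    unfolding eqpoll_iff_card_of_ordIso
    by (rule card_of_Times_same_infinite) (simp add: infinite_UNIV_char_0)
  finally show ?case .
qed

lemma simplex_lepoll_real: "topspace (simplex n) \<lesssim> (UNIV :: real set)"
proof -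
  have "topspace (simplex n) \<subseteq> {x. \<forall>i\<ge>Suc n. x i = 0}"
    by (auto simp: standard_simplex_def)
  then show ?thesis
    using finitely_supported_lepoll_real subset_imp_lepoll lepoll_trans by blast
qed

text \<open>The test spaces of \<open>h_fibration\<close> live on \<open>'u\<close>, the simplices
  on sequences of reals. An injection \<open>e\<close> into \<open>'u\<close> exists by cardinality,
  and the topology is carried over along its inverse \<open>d\<close>.\<close>

lemma small_copy_of_simplex:
  assumes "(UNIV :: real set) \<prec> (UNIV :: 'u set)"
  obtains Z :: "'u topology" and e d where "Top_space Z"
    "continuous_map (simplex n) Z e" "continuous_map Z (simplex n) d"
    "\<And>s. s \<in> topspace (simplex n) \<Longrightarrow> d (e s) = s"
proof -
  let ?S = "topspace (simplex n)"
  have small: "?S \<prec> (UNIV :: 'u set)"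
    using lesspoll_trans1[OF simplex_lepoll_real assms] .
  then obtain e :: "_ \<Rightarrow> 'u" where e: "inj_on e ?S"
    using lesspoll_imp_lepoll unfolding lepoll_def by blast
  define d where "d = inv_into ?S e"
  define Z where "Z = pullback_topology (e ` ?S) d (simplex n)"
  have de: "d (e s) = s" if "s \<in> ?S" for s
    unfolding d_def using e that by (rule inv_into_f_f)
  have topZ: "topspace Z = e ` ?S"
    unfolding Z_def topspace_pullback_topology using de by auto
  have ce: "continuous_map (simplex n) Z e"
    unfolding Z_def using de
    by (intro continuous_map_pullback') (auto intro: continuous_map_eq[OF continuous_map_id])
  have cd: "continuous_map Z (simplex n) d"
    unfolding Z_def using continuous_map_pullback[OF continuous_map_id] by (simp add: id_def o_def)
  have "delta_generated Z"
    unfolding delta_generated_def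
  proof (intro allI impI)
    fix U
    assume U: "U \<subseteq> topspace Z" and "\<forall>p f. continuous_map (simplex p) Z f \<longrightarrow>
        openin (simplex p) {x \<in> topspace (simplex p). f x \<in> U}"
    \<comment> \<open>The map \<open>e\<close> is itself a singular simplex of \<open>Z\<close>, and
      this single test already detects open sets.\<close>
    then have "openin (simplex n) {x \<in> ?S. e x \<in> U}"
      using ce by blast
    moreover have "U = d -` {x \<in> ?S. e x \<in> U} \<inter> e ` ?S"
      using U de unfolding topZ by auto
    ultimately show "openin Z U"
      unfolding Z_def openin_pullback_topology by blast
  qed
  moreover have "topspace Z \<prec> (UNIV :: 'u set)"
    unfolding topZ using image_lepoll small by (rule lesspoll_trans1)
  ultimately have "Top_space Z"
    by (simp add: Top_space_def small_def)
  then show thesis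
    using that ce cd de by blast
qed

text \<open>Lifting against the copy \<open>Z\<close> passes to the simplex and from there to the
  disk, by two retractions. The simplex is interposed because its copy is readily seen to be
  Delta-generated.\<close>

theorem h_fibration_imp_q_fibration:
  assumes "(UNIV :: real set) \<prec> (UNIV :: 'u set)" and "h_fibration TYPE('u) X Y f"
  shows "q_fibration X Y f"
proof -
  have "homotopy_lifting (disk n) X Y f" for n
  proof -
    obtain Z :: "'u topology" and e d where Z: "Top_space Z"
      and ed: "continuous_map (simplex n) Z e" "continuous_map Z (simplex n) d"
        "\<And>s. s \<in> topspace (simplex n) \<Longrightarrow> d (e s) = s"
      using small_copy_of_simplex[OF assms(1)] by metis
    obtain e' d' where "continuous_map (disk n) (simplex n) e'" "continuous_map (simplex n) (disk n) d'"
      "\<And>s. s \<in> topspace (disk n) \<Longrightarrow> d' (e' s) = s"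
      using disk_retract_of_simplex[of n] by metis
    moreover have "homotopy_lifting Z X Y f"
      using assms(2) Z by (simp add: h_fibration_def)
    then have "homotopy_lifting (simplex n) X Y f"
      using ed by (rule homotopy_lifting_retract)
    ultimately show ?thesis
      using homotopy_lifting_retract by blast
  qed
  then show ?thesis
    using assms(2) by (simp add: q_fibration_def h_fibration_def)
qed

section \<open>Comparison of model structures on one category\<close>

text \<open>The retract argument: \<open>i\<close> is factored as a cofibration \<open>j\<close>
  followed by a trivial fibration \<open>p\<close>, and lifting \<open>i\<close> against
  \<open>p\<close> exhibits \<open>i\<close> as a retract of \<open>j\<close>.\<close>

lemma cofibration_iff_has_lifting:
  assumes M: "model_structure C M"
  shows "i \<in> Cof M \<longleftrightarrow> i \<in> Arr C \<and> (\<forall>p\<in>Fib M \<inter> Weq M. has_lifting C i p)"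
proof
  assume "i \<in> Cof M"
  then show "i \<in> Arr C \<and> (\<forall>p\<in>Fib M \<inter> Weq M. has_lifting C i p)"
    using M unfolding model_structure_def by blast
next
  assume i: "i \<in> Arr C \<and> (\<forall>p\<in>Fib M \<inter> Weq M. has_lifting C i p)"
  have cat: "is_category C"
    using M by (simp add: model_structure_def)
  obtain j p where j: "j \<in> Cof M" and p: "p \<in> Fib M \<inter> Weq M"
    and jp: "Cod C j = Dom C p" and ijp: "i = Cmp C p j"
    using M i unfolding model_structure_def by blast
  have arr: "j \<in> Arr C" "p \<in> Arr C"
    using M j p unfolding model_structure_def by blast+
  have ends: "Dom C i = Dom C j" "Cod C i = Cod C p"
    using cat arr jp ijp unfolding is_category_def Hom_def by blast+
  have obj: "Dom C i \<in> Obj C" "Cod C i \<in> Obj C"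
    using cat i unfolding is_category_def by blast+
  have id: "Idt C (Dom C i) \<in> Hom C (Dom C i) (Dom C i)" "Idt C (Cod C i) \<in> Hom C (Cod C i) (Cod C i)"
    using cat obj unfolding is_category_def by blast+
  have unit: "Cmp C f (Idt C (Dom C f)) = f" "Cmp C (Idt C (Cod C f)) f = f" if "f \<in> Arr C" for f
    using cat that unfolding is_category_def by blast+
  \<comment> \<open>The lift is taken in the square with \<open>j\<close> on top and the identity of
    the codomain of \<open>i\<close> at the bottom.\<close>
  obtain l where l: "l \<in> Hom C (Cod C i) (Dom C p)" "Cmp C l i = j" "Cmp C p l = Idt C (Cod C i)"
  proof -
    have "j \<in> Hom C (Dom C i) (Dom C p)"
      using arr jp ends by (simp add: Hom_def)
    moreover have "Idt C (Cod C i) \<in> Hom C (Cod C i) (Cod C p)"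
      using id ends by simp
    moreover have "Cmp C p j = Cmp C (Idt C (Cod C i)) i"
      using unit(2) i ijp by metis
    ultimately show thesis
      using i p that unfolding has_lifting_def by blast
  qed
  \<comment> \<open>On domains both maps are the identity; on codomains the inclusion is
    \<open>l\<close> and the retraction is \<open>p\<close>.\<close>
  have "retract_of_arrow C i j"
    unfolding retract_of_arrow_def
  proof (intro bexI conjI)
    show "Idt C (Dom C i) \<in> Hom C (Dom C i) (Dom C j)" "Idt C (Dom C i) \<in> Hom C (Dom C j) (Dom C i)"
      using id ends by simp_all
    show "l \<in> Hom C (Cod C i) (Cod C j)"
      using l jp by simp
    show "p \<in> Hom C (Cod C j) (Cod C i)"
      using arr jp ends by (simp add: Hom_def)
    show "Cmp C (Idt C (Dom C i)) (Idt C (Dom C i)) = Idt C (Dom C i)"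
      using unit(2)[of "Idt C (Dom C i)"] id by (simp add: Hom_def)
    show "Cmp C p l = Idt C (Cod C i)"
      by (rule l)
    show "Cmp C j (Idt C (Dom C i)) = Cmp C l i"
      using unit(1)[OF arr(1)] ends l by simp
    show "Cmp C i (Idt C (Dom C i)) = Cmp C p j"
      using unit(1) i ijp by metis
  qed
  then show "i \<in> Cof M"
    using M i j unfolding model_structure_def closed_under_retracts_def by blast
qed

lemma cofibrations_antimono:
  assumes "model_structure C M" "model_structure C N"
    and "Fib N \<inter> Weq N \<subseteq> Fib M \<inter> Weq M"
  shows "Cof M \<subseteq> Cof N"
proof
  fix i assume "i \<in> Cof M"
  then show "i \<in> Cof N"
    using assms(3) unfolding cofibration_iff_has_lifting[OF assms(1)]
      cofibration_iff_has_lifting[OF assms(2)] by blast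
qed

lemma cofibrant_mono: "Cof M \<subseteq> Cof N \<Longrightarrow> cofibrant C M X \<Longrightarrow> cofibrant C N X"
  unfolding cofibrant_def by blast

section \<open>The identity adjunction as a Quillen equivalence\<close>

lemma adjunction_identity:
  assumes "is_category C"
  shows "adjunction C C identity_functor identity_functor (\<lambda>X Y f. f)"
proof -
  have "is_functor C C identity_functor"
    using assms by (auto simp: is_functor_def identity_functor_def Hom_def is_category_def)
  then show ?thesis
    by (simp add: adjunction_def) (simp add: identity_functor_def bij_betw_def)
qed

text \<open>With equal weak equivalences, fewer fibrations means fewer trivial fibrations, hence
  more cofibrations, and the left adjoint preserves both classes. The condition on adjuncts holds
  because each arrow is its own adjunct.\<close>

lemma quillen_equivalence_identity:
  assumes "model_structure C M" "model_structure C N" "Weq M = Weq N" "Fib N \<subseteq> Fib M"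
  shows "quillen_equivalence C M C N identity_functor identity_functor (\<lambda>X Y f. f)"
proof -
  have "Cof M \<subseteq> Cof N"
    using assms by (intro cofibrations_antimono[of C]) auto
  moreover have "is_category C"
    using assms(1) by (simp add: model_structure_def)
  ultimately show ?thesis
    using assms adjunction_identity[of C]
    by (auto simp: quillen_equivalence_def quillen_adjunction_def identity_functor_def)
qed

section \<open>Comparison of the three structures on multipointed d-spaces\<close>

lemma on_path_spaces_mono:
  assumes "on_path_spaces K a" "\<And>X Y f. K X Y f \<Longrightarrow> L X Y f"
  shows "on_path_spaces L a"
  using assms by (auto simp: on_path_spaces_def)

theorem proposition6p18:
  fixes Mq Mm Mh :: "'u dspace_arrow arrow_classes"
  assumes "(UNIV :: real set) \<prec> (UNIV :: 'u set)"
    and "q_model_structure Mq"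
    and "m_model_structure Mm"
    and "h_model_structure Mh"
  shows "(\<forall>X. cofibrant GdTop Mq X \<longrightarrow> cofibrant GdTop Mm X) \<and>
    (\<forall>X. cofibrant GdTop Mm X \<longrightarrow> cofibrant GdTop Mh X) \<and>
    quillen_equivalence GdTop Mq GdTop Mm identity_functor identity_functor (\<lambda>X Y f. f)"
proof -
  have model: "model_structure GdTop Mq" "model_structure GdTop Mm" "model_structure GdTop Mh"
    using assms(2-4)
    by (simp_all add: q_model_structure_def m_model_structure_def h_model_structure_def
        path_model_structure_def)
  \<comment> \<open>The m-structure is mixed: it shares its weak equivalences with the q-structure
    and its fibrations with the h-structure.\<close>
  have weq_qm: "Weq Mq = Weq Mm" and fib_mh: "Fib Mm = Fib Mh"
    using assms(2-4)
    by (simp_all add: q_model_structure_def m_model_structure_def h_model_structure_def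
        path_model_structure_def)
  \<comment> \<open>The cardinality assumption enters here: it makes the simplices small enough to
    have copies among the test spaces of h-fibrations.\<close>
  have fib_mq: "Fib Mm \<subseteq> Fib Mq"
    using assms(2,3) on_path_spaces_mono[OF _ h_fibration_imp_q_fibration[OF assms(1)]]
    by (auto simp: q_model_structure_def m_model_structure_def path_model_structure_def)
  have weq_hm: "Weq Mh \<subseteq> Weq Mm"
    using assms(3,4) on_path_spaces_mono[OF _ homotopy_equivalence_imp_weak]
    by (auto simp: h_model_structure_def m_model_structure_def path_model_structure_def)
  have "Cof Mq \<subseteq> Cof Mm"
    using weq_qm fib_mq by (intro cofibrations_antimono[OF model(1,2)]) auto
  moreover have "Cof Mm \<subseteq> Cof Mh"
    using weq_hm fib_mh by (intro cofibrations_antimono[OF model(2,3)]) auto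
  moreover note quillen_equivalence_identity[OF model(1,2) weq_qm fib_mq]
  ultimately show ?thesis
    by (intro conjI allI impI) (blast intro: cofibrant_mono)+
qed

end
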